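(* Let $C\ge1$, let $Q$ be an interval, and let the Bellman functions $\boldsymbol b_{p,C},\boldsymbol B_{2,C},\boldsymbol A_{\delta,C},\boldsymbol D_{\lambda,C}$ and the explicit candidates $b_{p,C},B_{2,C},A_{\delta,C},D_{\lambda,C}$ on $\Omega_C$ be as defined in the context. The following inequalities hold pointwise on $\Omega_C$. (1) If $p\in[1,2]$, then $b_{p,C}\ge\boldsymbol b_{p,C}$. (2) $B_{2,C}\le\boldsymbol B_{2,C}$. (3) For $1\le\delta<1/\xi^+(C)$, $A_{\delta,C}\le\boldsymbol A_{\delta,C}$. (4) For any $\lambda\in\mathbb R$, $D_{\lambda,C}\le\boldsymbol D_{\lambda,C}$.
   Context: **Basic notation.** For an interval $J$, $\langle\varphi\rangle_J=\frac1{|J|}\int_J\varphi$. For an a.e. positive $w$ on an interval $Q$ with $w,\log w$ locally integrable, $[w]_{A_\infty(Q)}=\sup_{J\subset Q}\langle w\rangle_Je^{-\langle\log w\rangle_J}$ (supremum over all subintervals $J$ of $Q$). For $C\ge1$, $\Omega_C=\{x\in\mathbb R^2:\ e^{x_1}\le x_2\le Ce^{x_1}\}$, and for $x\in\Omega_C$ $$E_{x,C,Q}=\{\varphi\in L^1(Q):\ \langle\varphi\rangle_Q=x_1,\ \langle e^\varphi\rangle_Q=x_2,\ [e^\varphi]_{A_\infty(Q)}\le C\}.$$ **Bellman functions.** For $p\in[1,2]$, $\delta\ge1$, $\lambda\in\mathbb R$, $x\in\Omega_C$ (these do not depend on $Q$): $\boldsymbol b_{p,C}(x)=\inf\{\langle|\varphi|^p\rangle_Q:\varphi\in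 E_{x,C,Q}\}$, $\boldsymbol B_{2,C}(x)=\sup\{\langle\varphi^2\rangle_Q:\varphi\in E_{x,C,Q}\}$, $\boldsymbol A_{\delta,C}(x)=\sup\{\langle e^{\delta\varphi}\rangle_Q:\varphi\in E_{x,C,Q}\}$, $\boldsymbol D_{\lambda,C}(x)=\sup\{\frac1{|Q|}|\{t\in Q:\varphi(t)\ge\lambda\}|:\varphi\in E_{x,C,Q}\}$. **Auxiliary functions.** $\xi^\pm=\xi^\pm(C)$ are the two solutions of $e^{-\xi}=C(1-\xi)$ with $-\infty<\xi^-\le0\le\xi^+<1$ (both $0$ when $C=1$, and then $1/\xi^+=\infty$). The functions $u^\pm=u^\pm(x)$ on $\Omega_C$ are defined implicitly by $$x_2=e^{u^\pm}\Big(\frac{x_1-u^\pm}{1-\xi^\pm}+1\Big),\qquad x_1-\xi^+\le u^+\le x_1,\qquad x_1\le u^-\le x_1-\xi^-.$$ **Candidates** (for $C>1$). For $p\in(1,2]$: $$b_{p,C}(x)=\frac p{\xi^+}\,e^{u^+/\xi^+}\Big[\int_{u^+}^\infty|s|^{p-1}\operatorname{sgn}(s)\,e^{-s/\xi^+}ds\Big](x_1-u^+)+|u^+|^p;$$ for $p=2$ this is $b_{2,C}(x)=2u^+x_1-(u^+)^2+2\xi^+(x_1-u^+)$. $$B_{2,C}(x)=2u^-x_1-(u^-)^2+2\xi^-(x_1-u^-).$$ $b_{1,C}$: write $\Omega_C=\Omega_-\cup\Omega_0\cup\Omega_+$ with $\Omega_-=\{x_1\le\xi^-,\ e^{x_1}\le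 x_2\le Ce^{x_1}\}\cup\{\xi^-\le x_1\le0,\ e^{x_1}\le x_2\le Ce^{\xi^-}x_1+1\}$, $\Omega_0=\{\xi^-\le x_1\le0,\ Ce^{\xi^-}x_1+1\le x_2\le Ce^{x_1}\}\cup\{0\le x_1\le\xi^+,\ Ce^{\xi^+}x_1+1\le x_2\le Ce^{x_1}\}$, $\Omega_+=\{0\le x_1\le\xi^+,\ e^{x_1}\le x_2\le Ce^{\xi^+}x_1+1\}\cup\{x_1\ge\xi^+,\ e^{x_1}\le x_2\le Ce^{x_1}\}$. Then $b_{1,C}(x)=-x_1$ on $\Omega_-$, $b_{1,C}(x)=x_1$ on $\Omega_+$, and on $\Omega_0$ $$b_{1,C}(x)=2\,\frac{(1-\xi^-)(1-\xi^+)}{\xi^+-\xi^-}\,(x_2-1)+\frac{\xi^++\xi^--2}{\xi^+-\xi^-}\,x_1.$$ For $1\le\delta<1/\xi^+$: $$A_{\delta,C}(x)=e^{\delta u^+}\Big(\frac{\delta}{1-\delta\xi^+}(x_1-u^+)+1\Big).$$ $D_{\lambda,C}$: write $\Omega_C=\bigcup_{k=1}^4\Omega_k(\lambda)$ with $\Omega_1(\lambda)=\{x_1\le\lambda+\xi^--\xi^+,\ e^{x_1}\le x_2\le Ce^{x_1}\}\cup\{\lambda+\xi^--\xi^+\le x_1\le\lambda+\xi^-,\ e^\lambda(Ce^{\xi^-}(x_1-\lambda)+1)\le x_2\le Ce^{x_1}\}$, $\Omega_2(\lambda)=\{\lambda+\xi^--\xi^+\le x_1<\lambda,\ e^{x_1}\le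 x_2\le e^\lambda(Ce^{\xi^-}(x_1-\lambda)+1)\}$, $\Omega_3(\lambda)=\{\lambda+\xi^-\le x_1\le\lambda,\ e^\lambda(Ce^{\xi^-}(x_1-\lambda)+1)\le x_2\le Ce^{x_1}\}\cup\{\lambda\le x_1\le\lambda+\xi^+,\ e^\lambda(Ce^{\xi^+}(x_1-\lambda)+1)\le x_2\le Ce^{x_1}\}$, $\Omega_4(\lambda)=\{\lambda\le x_1\le\lambda+\xi^+,\ e^{x_1}\le x_2\le e^\lambda(Ce^{\xi^+}(x_1-\lambda)+1)\}\cup\{x_1\ge\lambda+\xi^+,\ e^{x_1}\le x_2\le Ce^{x_1}\}$. For $x\in\Omega_2(\lambda)$ let $v=v(x)<\lambda$ be the horizontal coordinate of the second point where the line through $(\lambda,e^\lambda)$ and $x$ meets the curve $x_2=e^{x_1}$, i.e. $\frac{e^v-e^\lambda}{v-\lambda}=\frac{x_2-e^\lambda}{x_1-\lambda}$. Then $$D_{\lambda,C}(x)=\begin{cases}1,&x\in\Omega_4(\lambda),\\ \frac{1-\xi^-}{(\xi^+-\xi^-)^2}\big[x_1-\lambda+(1-x_2e^{-\lambda})(1-\xi^+)\big]+1,&x\in\Omega_3(\lambda),\\ \frac{x_1-v}{\lambda-v},&x\in\Omega_2(\lambda),\\ \frac{1}{\xi^+-\xi^-}\,e^{(\xi^+-\xi^-+u^+-\lambda)/\xi^+}\,(x_1-u^+),&x\in\Omega_1(\lambda).\end{cases}$$ **Case $C=1$.** Then $\Omega_1=\{x_2=e^{x_1}\}$ and the candidates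 are understood as $b_{p,1}(t,e^t)=|t|^p$, $B_{2,1}(t,e^t)=t^2$, $A_{\delta,1}(t,e^t)=e^{\delta t}$, $D_{\lambda,1}(t,e^t)=\chi_{[\lambda,\infty)}(t)$. *)

theory Defs
  imports "HOL-Analysis.Analysis"
begin

text \<open>Intervals over which averages are taken: bounded and nondegenerate, with arbitrary
  (open or closed) endpoints.\<close>

definition proper_interval :: "real set \<Rightarrow> bool" where
  "proper_interval J \<longleftrightarrow> is_interval J \<and> bounded J \<and> interior J \<noteq> {}"

definition avg :: "real set \<Rightarrow> (real \<Rightarrow> real) \<Rightarrow> real" where
  "avg J f = (LINT t:J|lebesgue. f t) / measure lebesgue J"

text \<open>Averages of nonnegative functions that are not assumed integrable; the value may be
  \<open>\<infinity>\<close>.\<close>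

definition nn_avg :: "real set \<Rightarrow> (real \<Rightarrow> real) \<Rightarrow> ereal" where
  "nn_avg J f = enn2ereal ((\<integral>\<^sup>+ t\<in>J. ennreal (f t) \<partial>lebesgue) / emeasure lebesgue J)"

definition A_inf_char :: "real set \<Rightarrow> (real \<Rightarrow> real) \<Rightarrow> ereal" where
  "A_inf_char Q w =
     (SUP J\<in>{J. proper_interval J \<and> J \<subseteq> Q}. ereal (avg J w * exp (- avg J (\<lambda>t. ln (w t)))))"

definition Omega :: "real \<Rightarrow> (real \<times> real) set" where
  "Omega C = {(x1, x2). exp x1 \<le> x2 \<and> x2 \<le> C * exp x1}"

text \<open>Integrability of \<open>exp \<circ> \<phi>\<close> is stated explicitly since the Bochner integral is total.\<close>

definition E_set :: "real \<times> real \<Rightarrow> real \<Rightarrow> real set \<Rightarrow> (real \<Rightarrow> real) set" where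
  "E_set x C Q = {\<phi>. set_integrable lebesgue Q \<phi> \<and> set_integrable lebesgue Q (\<lambda>t. exp (\<phi> t)) \<and>
     avg Q \<phi> = fst x \<and> avg Q (\<lambda>t. exp (\<phi> t)) = snd x \<and>
     A_inf_char Q (\<lambda>t. exp (\<phi> t)) \<le> ereal C}"

definition bellman_b :: "real \<Rightarrow> real \<Rightarrow> real set \<Rightarrow> real \<times> real \<Rightarrow> ereal" where
  "bellman_b p C Q x = (INF \<phi>\<in>E_set x C Q. nn_avg Q (\<lambda>t. \<bar>\<phi> t\<bar> powr p))"

definition bellman_B2 :: "real \<Rightarrow> real set \<Rightarrow> real \<times> real \<Rightarrow> ereal" where
  "bellman_B2 C Q x = (SUP \<phi>\<in>E_set x C Q. nn_avg Q (\<lambda>t. (\<phi> t)\<^sup>2))"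

definition bellman_A :: "real \<Rightarrow> real \<Rightarrow> real set \<Rightarrow> real \<times> real \<Rightarrow> ereal" where
  "bellman_A \<delta> C Q x = (SUP \<phi>\<in>E_set x C Q. nn_avg Q (\<lambda>t. exp (\<delta> * \<phi> t)))"

definition bellman_D :: "real \<Rightarrow> real \<Rightarrow> real set \<Rightarrow> real \<times> real \<Rightarrow> ereal" where
  "bellman_D l C Q x =
     (SUP \<phi>\<in>E_set x C Q. ereal (measure lebesgue {t \<in> Q. l \<le> \<phi> t} / measure lebesgue Q))"

text \<open>Since \<open>(1 - \<xi>) * exp \<xi>\<close> increases from \<open>0\<close> to \<open>1\<close> on \<open>(-\<infinity>, 0]\<close> and decreases from \<open>1\<close> to
  \<open>0\<close> on \<open>[0, 1]\<close>, both descriptions below are uniquely satisfied for \<open>C \<ge> 1\<close>.\<close>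

definition xi_plus :: "real \<Rightarrow> real" where
  "xi_plus C = (THE \<xi>. 0 \<le> \<xi> \<and> \<xi> < 1 \<and> exp (- \<xi>) = C * (1 - \<xi>))"

definition xi_minus :: "real \<Rightarrow> real" where
  "xi_minus C = (THE \<xi>. \<xi> \<le> 0 \<and> exp (- \<xi>) = C * (1 - \<xi>))"

text \<open>For \<open>x \<in> Omega C\<close> the right-hand side of each equation is strictly monotone in \<open>u\<close> on the
  prescribed range, with extreme values \<open>exp x1\<close> and \<open>C * exp x1\<close>.\<close>

definition u_plus :: "real \<Rightarrow> real \<times> real \<Rightarrow> real" where
  "u_plus C x = (THE u. fst x - xi_plus C \<le> u \<and> u \<le> fst x \<and>
     snd x = exp u * ((fst x - u) / (1 - xi_plus C) + 1))"

definition u_minus :: "real \<Rightarrow> real \<times> real \<Rightarrow> real" where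
  "u_minus C x = (THE u. fst x \<le> u \<and> u \<le> fst x - xi_minus C \<and>
     snd x = exp u * ((fst x - u) / (1 - xi_minus C) + 1))"

definition Omega_neg :: "real \<Rightarrow> (real \<times> real) set" where
  "Omega_neg C =
     {(x1, x2). x1 \<le> xi_minus C \<and> exp x1 \<le> x2 \<and> x2 \<le> C * exp x1} \<union>
     {(x1, x2). xi_minus C \<le> x1 \<and> x1 \<le> 0 \<and>
        exp x1 \<le> x2 \<and> x2 \<le> C * exp (xi_minus C) * x1 + 1}"

definition Omega_zero :: "real \<Rightarrow> (real \<times> real) set" where
  "Omega_zero C =
     {(x1, x2). xi_minus C \<le> x1 \<and> x1 \<le> 0 \<and>
        C * exp (xi_minus C) * x1 + 1 \<le> x2 \<and> x2 \<le> C * exp x1} \<union>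
     {(x1, x2). 0 \<le> x1 \<and> x1 \<le> xi_plus C \<and>
        C * exp (xi_plus C) * x1 + 1 \<le> x2 \<and> x2 \<le> C * exp x1}"

definition Omega_pos :: "real \<Rightarrow> (real \<times> real) set" where
  "Omega_pos C =
     {(x1, x2). 0 \<le> x1 \<and> x1 \<le> xi_plus C \<and>
        exp x1 \<le> x2 \<and> x2 \<le> C * exp (xi_plus C) * x1 + 1} \<union>
     {(x1, x2). xi_plus C \<le> x1 \<and> exp x1 \<le> x2 \<and> x2 \<le> C * exp x1}"

text \<open>The three regions overlap only along common boundaries, where the formulas agree; likewise
  for the four regions of \<open>cand_D\<close>. In both cases the regions cover \<open>Omega C\<close>, so the final
  value \<open>0\<close> is taken only outside it.\<close>

definition cand_b1 :: "real \<Rightarrow> real \<times> real \<Rightarrow> real" where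
  "cand_b1 C x =
     (if x \<in> Omega_neg C then - fst x
      else if x \<in> Omega_pos C then fst x
      else if x \<in> Omega_zero C then
        2 * ((1 - xi_minus C) * (1 - xi_plus C) / (xi_plus C - xi_minus C)) * (snd x - 1)
          + (xi_plus C + xi_minus C - 2) / (xi_plus C - xi_minus C) * fst x
      else 0)"

definition cand_b :: "real \<Rightarrow> real \<Rightarrow> real \<times> real \<Rightarrow> real" where
  "cand_b p C x =
     (if C = 1 then \<bar>fst x\<bar> powr p
      else if p = 1 then cand_b1 C x
      else p / xi_plus C * exp (u_plus C x / xi_plus C)
             * (LINT s:{u_plus C x..}|lebesgue. \<bar>s\<bar> powr (p - 1) * sgn s * exp (- s / xi_plus C))
             * (fst x - u_plus C x)
           + \<bar>u_plus C x\<bar> powr p)"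

definition cand_B2 :: "real \<Rightarrow> real \<times> real \<Rightarrow> real" where
  "cand_B2 C x =
     (if C = 1 then (fst x)\<^sup>2
      else 2 * u_minus C x * fst x - (u_minus C x)\<^sup>2
           + 2 * xi_minus C * (fst x - u_minus C x))"

definition cand_A :: "real \<Rightarrow> real \<Rightarrow> real \<times> real \<Rightarrow> real" where
  "cand_A \<delta> C x =
     (if C = 1 then exp (\<delta> * fst x)
      else exp (\<delta> * u_plus C x) * (\<delta> / (1 - \<delta> * xi_plus C) * (fst x - u_plus C x) + 1))"

definition Omega_D1 :: "real \<Rightarrow> real \<Rightarrow> (real \<times> real) set" where
  "Omega_D1 l C =
     {(x1, x2). x1 \<le> l + xi_minus C - xi_plus C \<and> exp x1 \<le> x2 \<and> x2 \<le> C * exp x1} \<union>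
     {(x1, x2). l + xi_minus C - xi_plus C \<le> x1 \<and> x1 \<le> l + xi_minus C \<and>
        exp l * (C * exp (xi_minus C) * (x1 - l) + 1) \<le> x2 \<and> x2 \<le> C * exp x1}"

definition Omega_D2 :: "real \<Rightarrow> real \<Rightarrow> (real \<times> real) set" where
  "Omega_D2 l C =
     {(x1, x2). l + xi_minus C - xi_plus C \<le> x1 \<and> x1 < l \<and>
        exp x1 \<le> x2 \<and> x2 \<le> exp l * (C * exp (xi_minus C) * (x1 - l) + 1)}"

definition Omega_D3 :: "real \<Rightarrow> real \<Rightarrow> (real \<times> real) set" where
  "Omega_D3 l C =
     {(x1, x2). l + xi_minus C \<le> x1 \<and> x1 \<le> l \<and>
        exp l * (C * exp (xi_minus C) * (x1 - l) + 1) \<le> x2 \<and> x2 \<le> C * exp x1} \<union>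
     {(x1, x2). l \<le> x1 \<and> x1 \<le> l + xi_plus C \<and>
        exp l * (C * exp (xi_plus C) * (x1 - l) + 1) \<le> x2 \<and> x2 \<le> C * exp x1}"

definition Omega_D4 :: "real \<Rightarrow> real \<Rightarrow> (real \<times> real) set" where
  "Omega_D4 l C =
     {(x1, x2). l \<le> x1 \<and> x1 \<le> l + xi_plus C \<and>
        exp x1 \<le> x2 \<and> x2 \<le> exp l * (C * exp (xi_plus C) * (x1 - l) + 1)} \<union>
     {(x1, x2). l + xi_plus C \<le> x1 \<and> exp x1 \<le> x2 \<and> x2 \<le> C * exp x1}"

definition v_pt :: "real \<Rightarrow> real \<times> real \<Rightarrow> real" where
  "v_pt l x = (THE v. v < l \<and> (exp v - exp l) / (v - l) = (snd x - exp l) / (fst x - l))"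

definition cand_D :: "real \<Rightarrow> real \<Rightarrow> real \<times> real \<Rightarrow> real" where
  "cand_D l C x =
     (if C = 1 then indicator {l..} (fst x)
      else if x \<in> Omega_D4 l C then 1
      else if x \<in> Omega_D3 l C then
        (1 - xi_minus C) / (xi_plus C - xi_minus C)\<^sup>2
          * (fst x - l + (1 - snd x * exp (- l)) * (1 - xi_plus C)) + 1
      else if x \<in> Omega_D2 l C then (fst x - v_pt l x) / (l - v_pt l x)
      else if x \<in> Omega_D1 l C then
        1 / (xi_plus C - xi_minus C)
          * exp ((xi_plus C - xi_minus C + u_plus C x - l) / xi_plus C) * (fst x - u_plus C x)
      else 0)"

end

theory Submission
  imports Defs "HOL-Real_Asymp.Real_Asymp"
begin

text \<open>For every point of \<open>Omega C\<close> a function on \<open>[0, 1]\<close> realising the candidate is written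
  down: a constant continued by a logarithm \<open>u + \<xi> * ln (\<alpha> / t)\<close>, two logarithms joined by a
  constant, a two-valued function, or a mixture of these. Two facts keep the averages over all
  subintervals below the arc \<open>x2 = C * exp x1\<close>. First, a point below some tangent of the convex arc
  is below the arc; the averages of a logarithm over \<open>(0, s)\<close> are on the arc, hence above every
  tangent, whereas those over \<open>(0, t)\<close> are on the tangent through \<open>(\<phi> t, exp (\<phi> t))\<close>, so those over
  \<open>(s, t)\<close> are below it. Secondly, by convexity of \<open>exp\<close>, if the averages over \<open>I \<union> J\<close> are below
  the arc and those over \<open>I\<close> are on or above it, then those over \<open>J\<close> are below it.\<close>

section \<open>Primitives and averages\<close>

text \<open>The line through \<open>(u, exp u)\<close> and \<open>x\<close> that defines
  \<open>u_plus\<close> or \<open>u_minus\<close> is tangent to the arc and touches it over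
  \<open>u + \<xi>\<close>. As \<open>ln (\<alpha> / t)\<close> has mean 1 over
  \<open>(0, \<alpha>)\<close>, the logarithm averages there to the tangency point, so
  \<open>\<alpha>\<close> is the share of that point in \<open>x\<close>; the equation for
  \<open>\<xi>\<close> says that \<open>(u + \<xi>, exp u / (1 - \<xi>))\<close> is on the arc. The
  root \<open>xi_plus\<close> gives logarithms tending to \<infinity> at \<open>0\<close>,
  \<open>xi_minus\<close> those tending to -\<infinity>. The obstacle is the supremum over all
  subintervals, above all over those that straddle two pieces of a composed extremal. For the level
  sets, write \<open>p\<close> and \<open>m\<close> for the two roots. Dividing their equations
  gives \<open>exp (p - m) = (1 - m) / (1 - p)\<close>: the tangent with root \<open>p\<close>
  through the boundary point over \<open>l - (p - m)\<close> and the tangent with root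
  \<open>m\<close> through that over \<open>l\<close> are one line. Hence the values
  \<open>l\<close> and \<open>l - (p - m)\<close>, suitably mixed, average to a point of the arc,
  and a two-valued step can replace a logarithm.\<close>

definition primitive_on :: "real \<Rightarrow> real \<Rightarrow> (real \<Rightarrow> real) \<Rightarrow> (real \<Rightarrow> real) \<Rightarrow> bool" where
  "primitive_on a b F f \<longleftrightarrow> (\<forall>s t. a \<le> s \<and> s \<le> t \<and> t \<le> b \<longrightarrow> (f has_integral F t - F s) {s..t})"

lemma primitive_onD:
  "primitive_on a b F f \<Longrightarrow> a \<le> s \<Longrightarrow> s \<le> t \<Longrightarrow> t \<le> b \<Longrightarrow> (f has_integral F t - F s) {s..t}"
  unfolding primitive_on_def by blast

lemma primitive_on_subset:
  "primitive_on a b F f \<Longrightarrow> a \<le> c \<Longrightarrow> d \<le> b \<Longrightarrow> primitive_on c d F f"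
  unfolding primitive_on_def by (meson order_trans)

lemma primitive_on_degenerate: "primitive_on a a F f"
  unfolding primitive_on_def by (auto intro: has_integral_null_eq[THEN iffD2] simp: antisym_conv has_integral_refl)

text \<open>Derivatives are asked for only inside the interval, so an unbounded logarithm is covered
  as soon as its primitive is continuous at the singularity.\<close>

lemma primitive_on_deriv:
  assumes "continuous_on {a..b} F"
    and "\<And>t. a < t \<Longrightarrow> t < b \<Longrightarrow> (F has_real_derivative f t) (at t)"
  shows "primitive_on a b F f"
  unfolding primitive_on_def
proof clarify
  fix s t assume st: "a \<le> s" "s \<le> t" "t \<le> b"
  show "(f has_integral F t - F s) {s..t}"
  proof (rule fundamental_theorem_of_calculus_interior[OF st(2)])
    show "continuous_on {s..t} F" using assms(1) st by (auto intro: continuous_on_subset)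
    show "(F has_vector_derivative f x) (at x)" if "x \<in> {s<..<t}" for x
      using assms(2)[of x] that st by (simp add: has_real_derivative_iff_has_vector_derivative)
  qed
qed

lemma primitive_on_glue:
  assumes "primitive_on a c F f" "primitive_on c b H h" "F c = H c"
  shows "primitive_on a b (\<lambda>t. if t \<le> c then F t else H t) (\<lambda>t. if t \<le> c then f t else h t)"
  unfolding primitive_on_def
proof clarify
  let ?F = "\<lambda>t. if t \<le> c then F t else H t" and ?f = "\<lambda>t. if t \<le> c then f t else h t"
  have L: "(?f has_integral ?F t - ?F s) {s..t}" if "a \<le> s" "s \<le> t" "t \<le> c" for s t
  proof -
    have "(?f has_integral F t - F s) {s..t}"
      by (rule has_integral_eq[OF _ primitive_onD[OF assms(1) that]]) (use that in auto)
    then show ?thesis using that by simp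
  qed
  have R: "(?f has_integral ?F t - ?F s) {s..t}" if "c \<le> s" "s \<le> t" "t \<le> b" for s t
  proof -
    have "(?f has_integral H t - H s) {s..t}"
      by (rule has_integral_spike[OF negligible_sing[of c] _ primitive_onD[OF assms(2) that]])
        (use that in auto)
    moreover have "?F t = H t" "?F s = H s" using that assms(3) by (auto simp: antisym_conv)
    ultimately show ?thesis by simp
  qed
  fix s t assume st: "a \<le> s" "s \<le> t" "t \<le> b"
  consider "t \<le> c" | "c \<le> s" | "s \<le> c" "c \<le> t" by linarith
  then show "(?f has_integral ?F t - ?F s) {s..t}"
  proof cases
    case 3
    have "(?f has_integral (?F c - ?F s) + (?F t - ?F c)) {s..t}"
      by (rule has_integral_combine[OF 3 L R]) (use st 3 in auto)
    moreover have "(x - y) + (z - x) = z - y" for x y z :: real by simp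
    ultimately show ?thesis by (simp only:)
  qed (use L R st in blast)+
qed

lemma primitive_on_const: "primitive_on a b (\<lambda>t. c * t + d) (\<lambda>t. c)"
  by (rule primitive_on_deriv) (auto intro!: continuous_intros derivative_eq_intros)

lemma primitive_on_cong:
  assumes "primitive_on a b F f" and "\<And>t. a < t \<Longrightarrow> t < b \<Longrightarrow> f t = g t"
  shows "primitive_on a b F g"
  unfolding primitive_on_def
proof clarify
  fix s t assume st: "a \<le> s" "s \<le> t" "t \<le> b"
  show "(g has_integral F t - F s) {s..t}"
    by (rule has_integral_spike_finite[OF _ _ primitive_onD[OF assms(1) st], of "{a,b}"])
      (use assms(2) st in auto)
qed

text \<open>Moves the singularity of a logarithm from \<open>0\<close> to \<open>1\<close>, for
  extremals with a logarithm at either end.\<close>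

lemma primitive_on_reflect:
  assumes "primitive_on a b F f"
  shows "primitive_on (1 - b) (1 - a) (\<lambda>t. d - F (1 - t)) (\<lambda>t. f (1 - t))"
  unfolding primitive_on_def
proof clarify
  fix s t assume st: "1 - b \<le> s" "s \<le> t" "t \<le> 1 - a"
  have "(f has_integral F (1 - s) - F (1 - t)) (cbox (1 - t) (1 - s))"
    using primitive_onD[OF assms, of "1 - t" "1 - s"] st by simp
  from has_integral_affinity[OF this, of "-1" 1]
  have "((\<lambda>x. f (1 - x)) has_integral F (1 - s) - F (1 - t)) ((\<lambda>x. 1 - x) ` {1 - t..1 - s})"
    by (simp add: algebra_simps)
  moreover have "(\<lambda>x. 1 - x) ` {1 - t..1 - s} = {s..t}"
    using st by (auto simp: image_iff intro!: bexI[of _ "1 - _"])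
  ultimately show "((\<lambda>t. f (1 - t)) has_integral d - F (1 - t) - (d - F (1 - s))) {s..t}"
    by simp
qed

section \<open>Lebesgue averages over intervals with arbitrary endpoints\<close>

lemma proper_interval_endpoints:
  assumes "proper_interval J"
  obtains c d where "c < d" "{c<..<d} \<subseteq> J" "J \<subseteq> {c..d}"
proof -
  have J: "is_interval J" "bounded J" "interior J \<noteq> {}"
    using assms by (auto simp: proper_interval_def)
  have bd: "bdd_below J" "bdd_above J" using J(2) by (auto intro: bounded_imp_bdd_below bounded_imp_bdd_above)
  from J(3) obtain x where "x \<in> interior J" by blast
  then obtain e where e: "e > 0" "cball x e \<subseteq> J"
    by (meson mem_interior_cball)
  then have x: "x \<in> J" "x + e \<in> J" by (auto simp: dist_real_def subset_iff)
  have ne: "J \<noteq> {}" using x by auto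
  have "Inf J \<le> x" "x + e \<le> Sup J" using x bd by (auto intro: cInf_lower cSup_upper)
  then have "Inf J < Sup J" using e by simp
  moreover have "J \<subseteq> {Inf J..Sup J}" using bd by (auto intro: cInf_lower cSup_upper)
  moreover have "{Inf J<..<Sup J} \<subseteq> J"
  proof
    fix y assume "y \<in> {Inf J<..<Sup J}"
    then obtain p q where "p \<in> J" "p < y" "q \<in> J" "y < q"
      using cInf_less_iff[OF ne bd(1)] less_cSup_iff[OF ne bd(2)] by auto
    then show "y \<in> J" using J(1) unfolding is_interval_1 by (meson less_imp_le)
  qed
  ultimately show ?thesis using that by blast
qed

context
  fixes J :: "real set" and c d :: real
  assumes cd: "c < d" "{c<..<d} \<subseteq> J" "J \<subseteq> {c..d}"
begin

lemma interval_negligible: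
  "negligible ({c..d} - J)" "negligible (J - {c..d})"
proof -
  have "{c..d} - J \<subseteq> {c, d}" using cd by force
  then show "negligible ({c..d} - J)" by (meson finite.intros finite_subset negligible_finite)
qed (use cd in \<open>simp add: Diff_eq_empty_iff[THEN iffD2]\<close>)

lemma interval_lmeasurable: "J \<in> lmeasurable" and measure_interval: "measure lebesgue J = d - c"
proof -
  have neg: "negligible (sym_diff {c..d} J)"
    using interval_negligible by (simp add: negligible_Un)
  have L: "{c..d} \<in> lmeasurable" by simp
  show "J \<in> lmeasurable"
    using lmeasurable_negligible_symdiff[OF L neg] .
  have "measure lebesgue J = measure lebesgue {c..d}"
    using measure_negligible_symdiff[OF L neg] .
  then show "measure lebesgue J = d - c" using cd by simp
qed

lemma interval_has_integral:
  fixes f :: "real \<Rightarrow> real"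
  assumes "(f has_integral I) {c..d}"
  shows "(f has_integral I) J"
  using assms interval_negligible
  by (subst has_integral_spike_set_eq[of J "{c..d}"]) (auto elim: negligible_subset)

lemma interval_avg:
  fixes f :: "real \<Rightarrow> real"
  assumes "f absolutely_integrable_on {c..d}" "(f has_integral I) {c..d}"
  shows "f absolutely_integrable_on J" "avg J f = I / (d - c)"
proof -
  show ai: "f absolutely_integrable_on J"
    using assms(1) interval_negligible
    by (subst absolutely_integrable_spike_set_eq[of J "{c..d}"]) (auto elim: negligible_subset)
  then have "(LINT t:J|lebesgue. f t) = I"
    using interval_has_integral[OF assms(2)]
    by (simp add: set_lebesgue_integral_eq_integral(2) integral_unique)
  then show "avg J f = I / (d - c)" by (simp add: avg_def measure_interval)
qed

lemma interval_nn_avg: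
  fixes f :: "real \<Rightarrow> real"
  assumes "(f has_integral I) {c..d}" "\<And>t. 0 \<le> f t"
  shows "nn_avg J f = ereal (I / (d - c))"
proof -
  have hi: "(f has_integral I) J" by (rule interval_has_integral[OF assms(1)])
  have ai: "f absolutely_integrable_on J"
    using hi assms(2) by (intro nonnegative_absolutely_integrable_1) auto
  have I0: "0 \<le> I" using has_integral_nonneg[OF hi] assms(2) by simp
  have "(\<integral>\<^sup>+ t\<in>J. ennreal (f t) \<partial>lebesgue) = (\<integral>\<^sup>+ t. ennreal (indicator J t *\<^sub>R f t) \<partial>lebesgue)"
    by (rule nn_integral_cong) (auto simp: indicator_def)
  also have "\<dots> = ennreal (LINT t:J|lebesgue. f t)"
    unfolding set_lebesgue_integral_def
    by (rule nn_integral_eq_integral) (use ai assms(2) in \<open>auto simp: set_integrable_def\<close>)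
  also have "(LINT t:J|lebesgue. f t) = I"
    using ai hi by (simp add: set_lebesgue_integral_eq_integral(2) integral_unique)
  finally have 1: "(\<integral>\<^sup>+ t\<in>J. ennreal (f t) \<partial>lebesgue) = ennreal I" .
  have 2: "emeasure lebesgue J = ennreal (d - c)"
    using interval_lmeasurable measure_interval by (simp add: emeasure_eq_measure2)
  show ?thesis
    unfolding nn_avg_def 1 2 using I0 cd by (simp add: divide_ennreal enn2ereal_ennreal)
qed

end

text \<open>Recovers Lebesgue integrability from the gauge integral by the one-sided bound
  \<open>f \<le> exp f\<close>, which also serves logarithms that tend to -\<infinity>.\<close>

lemma absolutely_integrable_if_exp:
  fixes f :: "real \<Rightarrow> real"
  assumes "((\<lambda>t. exp (f t)) has_integral K) {c..d}" "(f has_integral I) {c..d}"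
  shows "(\<lambda>t. exp (f t)) absolutely_integrable_on {c..d}" "f absolutely_integrable_on {c..d}"
proof -
  show e: "(\<lambda>t. exp (f t)) absolutely_integrable_on {c..d}"
    using assms(1) by (intro nonnegative_absolutely_integrable_1) auto
  show "f absolutely_integrable_on {c..d}"
  proof (rule absolutely_integrable_absolutely_integrable_ubound[OF _ e])
    show "f x \<le> exp (f x)" for x using exp_ge_add_one_self[of "f x"] by linarith
  qed (use assms(2) in auto)
qed

text \<open>For primitives \<open>F\<close> of \<open>\<phi>\<close> and \<open>G\<close> of \<open>exp \<circ> \<phi>\<close>: the point of averages of \<open>\<phi>\<close> and
  \<open>exp \<circ> \<phi>\<close> over \<open>[s, t]\<close> lies below the upper boundary of \<open>Omega C\<close>.\<close>

definition below_arc :: "real \<Rightarrow> (real \<Rightarrow> real) \<Rightarrow> (real \<Rightarrow> real) \<Rightarrow> real \<Rightarrow> real \<Rightarrow> bool" where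
  "below_arc C F G s t \<longleftrightarrow> G t - G s \<le> C * (t - s) * exp ((F t - F s) / (t - s))"

lemma primitive_on_rescale:
  assumes "primitive_on 0 1 F f" "a < b" "a \<le> c" "c \<le> d" "d \<le> b"
  shows "((\<lambda>t. f ((t - a) / (b - a))) has_integral
           (b - a) * (F ((d - a) / (b - a)) - F ((c - a) / (b - a)))) {c..d}"
proof -
  let ?m = "1 / (b - a)"
  have ab: "b - a > 0" using assms by simp
  have "(f has_integral F ((d - a) / (b - a)) - F ((c - a) / (b - a)))
      (cbox ((c - a) / (b - a)) ((d - a) / (b - a)))"
    using primitive_onD[OF assms(1), of "(c - a) / (b - a)" "(d - a) / (b - a)"] assms ab
    by (simp add: divide_simps)
  from has_integral_affinity[OF this, of ?m "- a / (b - a)"] ab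
  have "((\<lambda>t. f ((t - a) / (b - a))) has_integral
           (b - a) * (F ((d - a) / (b - a)) - F ((c - a) / (b - a))))
        ((\<lambda>x. (b - a) * x + a) ` {(c - a) / (b - a)..(d - a) / (b - a)})"
    by (simp add: diff_divide_distrib)
  also have "(\<lambda>x. (b - a) * x + a) ` {(c - a) / (b - a)..(d - a) / (b - a)} = {c..d}"
    using ab assms image_affinity_atLeastAtMost[of "b - a" a "(c - a) / (b - a)" "(d - a) / (b - a)"]
    by (simp add: divide_right_mono)
  finally show ?thesis .
qed

text \<open>Rescaled from \<open>[0, 1]\<close> to \<open>Q\<close>, such data give a member of
  \<open>E_set\<close> at the point of increments of \<open>F\<close> and \<open>G\<close>. Each
  Bellman bound then only asks for one further primitive \<open>H\<close>, or for a lower bound on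
  \<open>\<phi>\<close> near \<open>0\<close>.\<close>

locale extremal =
  fixes C :: real and Q :: "real set" and a b :: real and \<phi> F G :: "real \<Rightarrow> real"
  assumes Q: "a < b" "{a<..<b} \<subseteq> Q" "Q \<subseteq> {a..b}"
    and F: "primitive_on 0 1 F \<phi>" and G: "primitive_on 0 1 G (\<lambda>t. exp (\<phi> t))"
    and below: "\<And>s t. 0 \<le> s \<Longrightarrow> s < t \<Longrightarrow> t \<le> 1 \<Longrightarrow> below_arc C F G s t"
begin

definition \<psi> :: "real \<Rightarrow> real" where "\<psi> t = \<phi> ((t - a) / (b - a))"

lemma avg_\<psi>:
  assumes J: "c < d" "{c<..<d} \<subseteq> J" "J \<subseteq> {c..d}" and "a \<le> c" "d \<le> b"
  shows "\<psi> absolutely_integrable_on J" "(\<lambda>t. exp (\<psi> t)) absolutely_integrable_on J"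
    "avg J \<psi> = (b - a) * (F ((d - a) / (b - a)) - F ((c - a) / (b - a))) / (d - c)"
    "avg J (\<lambda>t. exp (\<psi> t)) = (b - a) * (G ((d - a) / (b - a)) - G ((c - a) / (b - a))) / (d - c)"
proof -
  note f = primitive_on_rescale[OF F Q(1) assms(4) less_imp_le[OF J(1)] assms(5), folded \<psi>_def]
  note g = primitive_on_rescale[OF G Q(1) assms(4) less_imp_le[OF J(1)] assms(5), folded \<psi>_def]
  note i = absolutely_integrable_if_exp[OF g f]
  from interval_avg[OF J i(1) g] interval_avg[OF J i(2) f]
  show "\<psi> absolutely_integrable_on J" "(\<lambda>t. exp (\<psi> t)) absolutely_integrable_on J"
    "avg J \<psi> = (b - a) * (F ((d - a) / (b - a)) - F ((c - a) / (b - a))) / (d - c)"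
    "avg J (\<lambda>t. exp (\<psi> t)) = (b - a) * (G ((d - a) / (b - a)) - G ((c - a) / (b - a))) / (d - c)"
    by blast+
qed

lemma in_E_set: "\<psi> \<in> E_set (F 1 - F 0, G 1 - G 0) C Q"
proof -
  note q = avg_\<psi>[OF Q order_refl order_refl]
  have "ereal (avg J (\<lambda>t. exp (\<psi> t)) * exp (- avg J (\<lambda>t. ln (exp (\<psi> t))))) \<le> ereal C"
    if "proper_interval J" "J \<subseteq> Q" for J
  proof -
    from proper_interval_endpoints[OF that(1)] obtain c d
      where J: "c < d" "{c<..<d} \<subseteq> J" "J \<subseteq> {c..d}" .
    have "{c<..<d} \<subseteq> {a..b}" using J(2) that(2) Q(3) by blast
    then have cd: "a \<le> c" "d \<le> b" using J(1) by (simp_all add: greaterThanLessThan_subseteq_atLeastAtMost_iff)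
    let ?s = "(c - a) / (b - a)" and ?t = "(d - a) / (b - a)"
    have ts: "?t - ?s = (d - c) / (b - a)" by (simp add: diff_divide_distrib)
    have "below_arc C F G ?s ?t"
      by (rule below) (use Q(1) J(1) cd in \<open>auto simp: divide_simps\<close>)
    then have "(G ?t - G ?s) \<le> C * ((d - c) / (b - a)) * exp ((b - a) * (F ?t - F ?s) / (d - c))"
      unfolding below_arc_def ts by (simp add: mult.commute)
    then have "avg J (\<lambda>t. exp (\<psi> t)) \<le> C * exp (avg J \<psi>)"
      unfolding avg_\<psi>[OF J cd] using Q(1) J(1) by (simp add: divide_simps mult_ac)
    then have "avg J (\<lambda>t. exp (\<psi> t)) * exp (- avg J \<psi>) \<le> C"
      by (simp add: exp_minus divide_simps)
    then show ?thesis by simp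
  qed
  then have "A_inf_char Q (\<lambda>t. exp (\<psi> t)) \<le> ereal C"
    unfolding A_inf_char_def by (intro SUP_least) auto
  then show ?thesis using q Q(1) by (simp add: E_set_def)
qed

lemma nn_avg_\<psi>:
  assumes "primitive_on 0 1 H (\<lambda>t. g (\<phi> t))" "\<And>y. 0 \<le> g y"
  shows "nn_avg Q (\<lambda>t. g (\<psi> t)) = ereal (H 1 - H 0)"
  using interval_nn_avg[OF Q primitive_on_rescale[OF assms(1) Q(1) order_refl less_imp_le[OF Q(1)] order_refl]]
    assms(2) Q(1) by (simp add: \<psi>_def)

lemma bellman_b_le:
  assumes "primitive_on 0 1 H (\<lambda>t. \<bar>\<phi> t\<bar> powr p)"
  shows "bellman_b p C Q (F 1 - F 0, G 1 - G 0) \<le> ereal (H 1 - H 0)"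
  unfolding bellman_b_def
  using INF_lower[OF in_E_set, of "\<lambda>\<phi>. nn_avg Q (\<lambda>t. \<bar>\<phi> t\<bar> powr p)"]
    nn_avg_\<psi>[of H "\<lambda>y. \<bar>y\<bar> powr p", OF assms] by simp

lemma bellman_B2_ge:
  assumes "primitive_on 0 1 H (\<lambda>t. (\<phi> t)\<^sup>2)"
  shows "ereal (H 1 - H 0) \<le> bellman_B2 C Q (F 1 - F 0, G 1 - G 0)"
  unfolding bellman_B2_def
  using SUP_upper[OF in_E_set, of "\<lambda>\<phi>. nn_avg Q (\<lambda>t. (\<phi> t)\<^sup>2)"]
    nn_avg_\<psi>[of H "\<lambda>y. y\<^sup>2", OF assms] by simp

lemma bellman_A_ge:
  assumes "primitive_on 0 1 H (\<lambda>t. exp (\<delta> * \<phi> t))"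
  shows "ereal (H 1 - H 0) \<le> bellman_A \<delta> C Q (F 1 - F 0, G 1 - G 0)"
  unfolding bellman_A_def
  using SUP_upper[OF in_E_set, of "\<lambda>\<phi>. nn_avg Q (\<lambda>t. exp (\<delta> * \<phi> t))"]
    nn_avg_\<psi>[of H "\<lambda>y. exp (\<delta> * y)", OF assms] by simp

text \<open>The extremals for the level set problem keep their values \<open>\<ge> l\<close> next to
  \<open>0\<close>, so the level set contains the initial share \<open>\<beta>\<close> of
  \<open>Q\<close>.\<close>

lemma bellman_D_ge:
  assumes "0 \<le> \<beta>" "\<beta> \<le> 1" "\<And>t. 0 < t \<Longrightarrow> t < \<beta> \<Longrightarrow> l \<le> \<phi> t"
  shows "ereal \<beta> \<le> bellman_D l C Q (F 1 - F 0, G 1 - G 0)"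
proof -
  let ?S = "{t \<in> Q. l \<le> \<psi> t}" and ?I = "{a<..<a + \<beta> * (b - a)}"
  have le: "\<beta> * (b - a) \<le> b - a" using assms Q(1) by (simp add: mult_left_le_one_le)
  have sub: "?I \<subseteq> ?S"
  proof
    fix t assume t: "t \<in> ?I"
    then have "t \<in> Q" using Q(2) le by auto
    moreover have "l \<le> \<psi> t" unfolding \<psi>_def
      by (rule assms(3)) (use t Q(1) in \<open>auto simp: divide_simps\<close>)
    ultimately show "t \<in> ?S" by simp
  qed
  \<comment> \<open>The comparison of measures needs a measurable level set, since
    \<open>measure\<close> is 0 on non-measurable sets.\<close>
  have "\<psi> \<in> borel_measurable (lebesgue_on Q)"
    using avg_\<psi>(1)[OF Q order_refl order_refl] interval_lmeasurable[OF Q]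
    by (simp add: absolutely_integrable_measurable)
  then have "{t \<in> space (lebesgue_on Q). l \<le> \<psi> t} \<in> sets (lebesgue_on Q)"
    by measurable
  then have "?S \<in> sets lebesgue"
    using interval_lmeasurable[OF Q] by (auto simp: sets_restrict_space_iff)
  then have S: "?S \<in> lmeasurable"
    using interval_lmeasurable[OF Q] by (auto intro: fmeasurableI2)
  have "\<beta> * (b - a) = measure lebesgue ?I" using assms Q(1) by simp
  also have "\<dots> \<le> measure lebesgue ?S"
    by (rule measure_mono_fmeasurable[OF sub _ S]) simp
  finally have "\<beta> \<le> measure lebesgue ?S / measure lebesgue Q"
    using Q(1) by (simp add: measure_interval[OF Q] divide_simps)
  then show ?thesis
    unfolding bellman_D_def
    using SUP_upper[OF in_E_set, of "\<lambda>\<phi>. ereal (measure lebesgue {t \<in> Q. l \<le> \<phi> t} / measure lebesgue Q)"]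
    by (meson ereal_less_eq(3) order_trans)
qed

end

section \<open>Logarithms\<close>

definition logplus :: "real \<Rightarrow> real \<Rightarrow> real" where
  "logplus \<alpha> t = (if t \<le> \<alpha> then ln (\<alpha> / t) else 0)"

text \<open>With \<open>c = h 0\<close> this is a primitive of
  \<open>h (logplus \<alpha> t)\<close>; the offset makes the two pieces meet at
  \<open>t = \<alpha>\<close>. The value at \<open>1\<close> is the mixture of \<open>c\<close> and
  \<open>\<Phi> 0\<close> with weights \<open>1 - \<alpha>\<close> and \<open>\<alpha>\<close>, from
  which the candidates arise.\<close>

definition logprim :: "real \<Rightarrow> (real \<Rightarrow> real) \<Rightarrow> real \<Rightarrow> real \<Rightarrow> real" where
  "logprim \<alpha> \<Phi> c t = (if t \<le> \<alpha> then t * \<Phi> (ln (\<alpha> / t)) else c * t + \<alpha> * (\<Phi> 0 - c))"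

text \<open>In the variable \<open>y = ln (\<alpha> / t)\<close>, \<open>t * \<Phi> y\<close> is a primitive of \<open>h y\<close> exactly when
  \<open>\<Phi> - \<Phi>' = h\<close>; the limit condition makes it continuous at the singularity \<open>t = 0\<close>.\<close>

lemma primitive_on_log:
  assumes "0 \<le> \<alpha>"
    and deriv: "\<And>y. (\<Phi> has_real_derivative \<Phi> y - h y) (at y)"
    and lim: "((\<lambda>y. exp (- y) * \<Phi> y) \<longlongrightarrow> 0) at_top"
  shows "primitive_on 0 \<alpha> (\<lambda>t. t * \<Phi> (ln (\<alpha> / t))) (\<lambda>t. h (ln (\<alpha> / t)))"
proof (cases "\<alpha> = 0")
  case True
  then show ?thesis by (simp add: primitive_on_degenerate)
next
  case False
  then have \<alpha>: "0 < \<alpha>" using assms by simp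
  let ?F = "\<lambda>t. t * \<Phi> (ln (\<alpha> / t))"
  have d: "(?F has_real_derivative h (ln (\<alpha> / t))) (at t)" if "0 < t" for t
  proof -
    have 1: "((\<lambda>t. ln (\<alpha> / t)) has_real_derivative - 1 / t) (at t)"
      using \<alpha> that by (auto intro!: derivative_eq_intros simp: divide_simps)
    have 2: "((\<lambda>t. \<Phi> (ln (\<alpha> / t))) has_real_derivative (\<Phi> (ln (\<alpha> / t)) - h (ln (\<alpha> / t))) * (- 1 / t)) (at t)"
      by (rule DERIV_chain2[OF deriv 1])
    show ?thesis using that
      by (auto intro!: derivative_eq_intros 2 simp: field_simps)
  qed
  have "((\<lambda>t. \<alpha> * (exp (- ln (\<alpha> / t)) * \<Phi> (ln (\<alpha> / t)))) \<longlongrightarrow> \<alpha> * 0) (at_right 0)"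
  proof (intro tendsto_mult tendsto_const)
    have "filterlim (\<lambda>t. ln (\<alpha> / t)) at_top (at_right 0)" using \<alpha> by real_asymp
    then show "((\<lambda>t. exp (- ln (\<alpha> / t)) * \<Phi> (ln (\<alpha> / t))) \<longlongrightarrow> 0) (at_right 0)"
      by (rule filterlim_compose[OF lim])
  qed
  moreover have "\<forall>\<^sub>F t in at_right 0. \<alpha> * (exp (- ln (\<alpha> / t)) * \<Phi> (ln (\<alpha> / t))) = ?F t"
    using eventually_at_right_less
    by eventually_elim (use \<alpha> in \<open>simp add: exp_minus divide_simps\<close>)
  ultimately have "(?F \<longlongrightarrow> 0) (at_right 0)" by (simp add: filterlim_cong)
  then have c0: "(?F \<longlongrightarrow> ?F 0) (at 0 within {0..\<alpha>})"
    using \<alpha> by (simp add: at_within_Icc_at_right)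
  have "continuous_on {0..\<alpha>} ?F"
    unfolding continuous_on
  proof
    fix t assume "t \<in> {0..\<alpha>}"
    then consider "t = 0" | "0 < t" by fastforce
    then show "(?F \<longlongrightarrow> ?F t) (at t within {0..\<alpha>})"
    proof cases
      case 2
      then show ?thesis
        using DERIV_isCont[OF d[OF 2]] by (meson continuous_at_imp_continuous_at_within continuous_within)
    qed (use c0 in simp)
  qed
  then show ?thesis by (rule primitive_on_deriv) (use d in auto)
qed

lemma primitive_on_logplus:
  assumes "0 \<le> \<alpha>" "\<alpha> \<le> 1"
    and "\<And>y. (\<Phi> has_real_derivative \<Phi> y - h y) (at y)"
    and "((\<lambda>y. exp (- y) * \<Phi> y) \<longlongrightarrow> 0) at_top"
  shows "primitive_on 0 1 (logprim \<alpha> \<Phi> (h 0)) (\<lambda>t. h (logplus \<alpha> t))"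
proof -
  have "primitive_on 0 1 (\<lambda>t. if t \<le> \<alpha> then t * \<Phi> (ln (\<alpha> / t)) else h 0 * t + \<alpha> * (\<Phi> 0 - h 0))
      (\<lambda>t. if t \<le> \<alpha> then h (ln (\<alpha> / t)) else h 0)"
    by (rule primitive_on_glue[OF primitive_on_log[OF assms(1,3,4)] primitive_on_const])
      (simp add: algebra_simps)
  then show ?thesis by (simp add: logprim_def[abs_def] logplus_def if_distrib)
qed

lemma logprim_0: "0 \<le> \<alpha> \<Longrightarrow> logprim \<alpha> \<Phi> c 0 = 0"
  by (simp add: logprim_def)

lemma logprim_1: "0 \<le> \<alpha> \<Longrightarrow> \<alpha> \<le> 1 \<Longrightarrow> logprim \<alpha> \<Phi> c 1 = c + \<alpha> * (\<Phi> 0 - c)"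
  by (cases "\<alpha> = 1") (auto simp: logprim_def)

lemma logprim_ge: "\<alpha> \<le> t \<Longrightarrow> logprim \<alpha> \<Phi> c t = c * t + \<alpha> * (\<Phi> 0 - c)"
  by (cases "\<alpha> = t") (auto simp: logprim_def algebra_simps)

abbreviation logF :: "real \<Rightarrow> real \<Rightarrow> real \<Rightarrow> real \<Rightarrow> real" where
  "logF u \<xi> \<alpha> \<equiv> logprim \<alpha> (\<lambda>y. u + \<xi> + \<xi> * y) u"

abbreviation logG :: "real \<Rightarrow> real \<Rightarrow> real \<Rightarrow> real \<Rightarrow> real" where
  "logG u \<xi> \<alpha> \<equiv> logprim \<alpha> (\<lambda>y. exp (u + \<xi> * y) / (1 - \<xi>)) (exp u)"

lemma logF_conditions:
  fixes u \<xi> :: real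
  shows "((\<lambda>y. u + \<xi> + \<xi> * y) has_real_derivative (u + \<xi> + \<xi> * y) - (u + \<xi> * y)) (at y)"
    and "((\<lambda>y. exp (- y) * (u + \<xi> + \<xi> * y)) \<longlongrightarrow> 0) at_top"
  by (auto intro!: derivative_eq_intros) real_asymp

text \<open>The product in the limit decays like \<open>exp (- (1 - \<xi>) * y)\<close>. Applied to
  \<open>\<delta> * u\<close> and \<open>\<delta> * xi_plus C\<close>, this is where
  \<open>\<delta> < 1 / xi_plus C\<close> enters.\<close>

lemma logG_conditions:
  fixes u \<xi> :: real
  assumes "\<xi> < 1"
  shows "((\<lambda>y. exp (u + \<xi> * y) / (1 - \<xi>)) has_real_derivative
            exp (u + \<xi> * y) / (1 - \<xi>) - exp (u + \<xi> * y)) (at y)"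
    and "((\<lambda>y. exp (- y) * (exp (u + \<xi> * y) / (1 - \<xi>))) \<longlongrightarrow> 0) at_top"
proof -
  show "((\<lambda>y. exp (u + \<xi> * y) / (1 - \<xi>)) has_real_derivative
            exp (u + \<xi> * y) / (1 - \<xi>) - exp (u + \<xi> * y)) (at y)"
    using assms by (auto intro!: derivative_eq_intros simp: divide_simps) (simp add: algebra_simps)
  have "(\<lambda>y. exp (- y) * (exp (u + \<xi> * y) / (1 - \<xi>))) = (\<lambda>y. exp u / (1 - \<xi>) * exp (- (1 - \<xi>) * y))"
    by (auto simp: fun_eq_iff algebra_simps simp flip: exp_add)
  moreover have "((\<lambda>y. exp u / (1 - \<xi>) * exp (- c * y)) \<longlongrightarrow> 0) at_top" if "c > 0" for c
    using that by real_asymp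
  ultimately show "((\<lambda>y. exp (- y) * (exp (u + \<xi> * y) / (1 - \<xi>))) \<longlongrightarrow> 0) at_top"
    using assms by (simp only: diff_gt_0_iff_gt)
qed

text \<open>For a polynomial \<open>h\<close>, the sum of all derivatives
  \<open>h + h' + h'' + ...\<close> solves \<open>\<Phi> - \<Phi>' = h\<close>.\<close>

lemma square_conditions:
  fixes u \<xi> :: real
  defines "\<Phi> \<equiv> \<lambda>y. (u + \<xi> * y)\<^sup>2 + 2 * \<xi> * (u + \<xi> * y) + 2 * \<xi>\<^sup>2"
  shows "(\<Phi> has_real_derivative \<Phi> y - (u + \<xi> * y)\<^sup>2) (at y)"
    and "((\<lambda>y. exp (- y) * \<Phi> y) \<longlongrightarrow> 0) at_top"
  unfolding \<Phi>_def by (auto intro!: derivative_eq_intros simp: power2_eq_square algebra_simps) real_asymp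

section \<open>Powers of the modulus of a logarithm\<close>

lemma powr_abs_deriv:
  assumes "1 < p"
  shows "((\<lambda>s. \<bar>s\<bar> powr p) has_real_derivative p * (\<bar>s\<bar> powr (p - 1) * sgn s)) (at s)"
proof -
  consider "s > 0" | "s < 0" | "s = 0" by linarith
  then show ?thesis
  proof cases
    case 1
    have "((\<lambda>s. s powr p) has_real_derivative p * s powr (p - 1)) (at s)"
      using 1 by (auto intro!: derivative_eq_intros simp: powr_diff)
    then have "((\<lambda>s. \<bar>s\<bar> powr p) has_real_derivative p * s powr (p - 1)) (at s)"
      by (rule DERIV_cong_ev[OF refl _ refl, THEN iffD1, rotated])
        (use eventually_nhds_in_open[of "{0<..}" s] 1 in \<open>auto elim!: eventually_mono\<close>)
    then show ?thesis using 1 by simp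
  next
    case 2
    have "((\<lambda>s. (- s) powr p) has_real_derivative - (p * (- s) powr (p - 1))) (at s)"
      using 2 by (auto intro!: derivative_eq_intros simp: powr_diff)
    then have "((\<lambda>s. \<bar>s\<bar> powr p) has_real_derivative - (p * (- s) powr (p - 1))) (at s)"
      by (rule DERIV_cong_ev[OF refl _ refl, THEN iffD1, rotated])
        (use eventually_nhds_in_open[of "{..<0}" s] 2 in \<open>auto elim!: eventually_mono\<close>)
    then show ?thesis using 2 by simp
  next
    \<comment> \<open>The difference quotient has modulus \<open>\<bar>h\<bar> powr (p - 1)\<close>,
      which tends to 0 because \<open>p > 1\<close>; exponent 1 gets its own extremals.\<close>
    case 3
    have "((\<lambda>h::real. \<bar>h\<bar> powr (p - 1)) \<longlongrightarrow> \<bar>0\<bar> powr (p - 1)) (at 0)"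
      by (intro tendsto_intros) (use assms in \<open>auto\<close>)
    then have "((\<lambda>h::real. \<bar>h\<bar> powr (p - 1)) \<longlongrightarrow> 0) (at 0)" by simp
    then have "((\<lambda>h::real. \<bar>h\<bar> powr p / h) \<longlongrightarrow> 0) (at 0)"
      by (rule Lim_null_comparison[rotated])
        (auto simp: eventually_at_filter powr_diff abs_mult)
    then show ?thesis using 3 assms by (simp add: DERIV_def)
  qed
qed

text \<open>The jump of \<open>sgn\<close> at 0 is avoided by writing the product as a difference of
  powers of the positive and negative parts.\<close>

lemma signed_powr_continuous:
  assumes "0 < q"
  shows "continuous_on UNIV (\<lambda>s::real. \<bar>s\<bar> powr q * sgn s)"
proof -
  have "(\<lambda>s::real. \<bar>s\<bar> powr q * sgn s) = (\<lambda>s. (max s 0) powr q - (max (- s) 0) powr q)"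
    using assms by (auto simp: fun_eq_iff sgn_if max_def)
  moreover have "continuous_on UNIV (\<lambda>s::real. (max s 0) powr q - (max (- s) 0) powr q)"
    using assms by (intro continuous_on_diff continuous_on_powr' continuous_intros) auto
  ultimately show ?thesis by (simp only:)
qed

context
  fixes p \<xi> :: real
  assumes p: "1 < p" "p \<le> 2" and \<xi>: "0 < \<xi>"
begin

definition powr_kernel :: "real \<Rightarrow> real" where
  "powr_kernel r = \<bar>r\<bar> powr (p - 1) * sgn r * exp (- r / \<xi>)"

lemma powr_kernel_continuous: "continuous_on S powr_kernel"
  unfolding powr_kernel_def[abs_def] using p \<xi>
  by (intro continuous_on_mult continuous_on_subset[OF signed_powr_continuous] continuous_intros) auto

text \<open>Half of the decay rate \<open>1 / \<xi>\<close> absorbs the growth of the power; the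
  other half remains as integrable majorant.\<close>

lemma powr_kernel_bound:
  assumes "s \<le> r"
  defines "c \<equiv> 1 / (2 * \<xi>)"
  shows "\<bar>powr_kernel r\<bar> \<le> (1 + \<bar>s\<bar> + 1 / c) * exp (- c * s) * exp (- c * r)"
proof -
  have c: "c > 0" using \<xi> by (simp add: c_def)
  have "\<bar>r\<bar> powr (p - 1) \<le> 1 + \<bar>r\<bar>"
  proof (cases "\<bar>r\<bar> \<le> 1")
    case True
    then have "\<bar>r\<bar> powr (p - 1) \<le> 1" using p by (intro powr_le1) auto
    then show ?thesis by simp
  next
    case False
    then have "\<bar>r\<bar> powr (p - 1) \<le> \<bar>r\<bar> powr 1" using p by (intro powr_mono) auto
    then show ?thesis using False by simp
  qed
  also have "\<dots> \<le> 1 + \<bar>s\<bar> + (r - s)" using assms(1) by linarith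
  also have "\<dots> \<le> (1 + \<bar>s\<bar> + 1 / c) * (1 + c * (r - s))"
  proof -
    have "(1 + \<bar>s\<bar> + 1 / c) * (1 + c * (r - s)) =
        1 + \<bar>s\<bar> + (r - s) + (1 / c + (1 + \<bar>s\<bar>) * (c * (r - s)))"
      using c by (simp add: field_simps)
    moreover have "0 \<le> 1 / c + (1 + \<bar>s\<bar>) * (c * (r - s))" using c assms(1) by simp
    ultimately show ?thesis by linarith
  qed
  also have "\<dots> \<le> (1 + \<bar>s\<bar> + 1 / c) * exp (c * (r - s))"
    using c by (intro mult_left_mono exp_ge_add_one_self) auto
  finally have le: "\<bar>r\<bar> powr (p - 1) \<le> (1 + \<bar>s\<bar> + 1 / c) * exp (c * (r - s))" .
  have "\<bar>powr_kernel r\<bar> \<le> \<bar>r\<bar> powr (p - 1) * exp (- r / \<xi>)"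
    by (simp add: powr_kernel_def abs_mult abs_sgn_eq)
  also have "\<dots> \<le> (1 + \<bar>s\<bar> + 1 / c) * exp (c * (r - s)) * exp (- r / \<xi>)"
    using le by (intro mult_right_mono) auto
  also have "\<dots> = (1 + \<bar>s\<bar> + 1 / c) * (exp (c * (r - s)) * exp (- r / \<xi>))" by simp
  also have "exp (c * (r - s)) * exp (- r / \<xi>) = exp (- c * s) * exp (- c * r)"
  proof -
    have "c * (r - s) + - r / \<xi> = - c * s + - c * r" using \<xi> by (simp add: c_def field_simps)
    then show ?thesis by (simp only: exp_add[symmetric])
  qed
  finally show ?thesis by (simp only: mult.assoc)
qed

lemma powr_kernel_integrable:
  "powr_kernel absolutely_integrable_on {s..}"
  "(\<lambda>r. M * exp (- (1 / (2 * \<xi>)) * r)) integrable_on {s..}"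
proof -
  show i: "(\<lambda>r. M * exp (- (1 / (2 * \<xi>)) * r)) integrable_on {s..}" for M
    using has_integral_mult_right[OF has_integral_exp_minus_to_infinity[of "1 / (2 * \<xi>)" s], of M] \<xi>
    by (auto simp: integrable_on_def)
  show "powr_kernel absolutely_integrable_on {s..}"
  proof (rule measurable_bounded_by_integrable_imp_absolutely_integrable[OF _ _ i])
    show "powr_kernel \<in> borel_measurable (lebesgue_on {s..})"
      by (intro continuous_imp_measurable_on_sets_lebesgue powr_kernel_continuous) simp
    show "norm (powr_kernel r) \<le> (1 + \<bar>s\<bar> + 1 / (1 / (2 * \<xi>))) * exp (- (1 / (2 * \<xi>)) * s)
        * exp (- (1 / (2 * \<xi>)) * r)" if "r \<in> {s..}" for r
      using powr_kernel_bound[of s r] that by simp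
  qed simp
qed

definition powr_tail :: "real \<Rightarrow> real" where
  "powr_tail s = (LINT r:{s..}|lebesgue. powr_kernel r)"

lemma powr_tail_eq: "powr_tail s = integral {s..} powr_kernel"
  unfolding powr_tail_def by (rule set_lebesgue_integral_eq_integral(2)[OF powr_kernel_integrable(1)])

lemma powr_tail_deriv: "(powr_tail has_real_derivative - powr_kernel s) (at s)"
proof -
  \<comment> \<open>A fixed base point to the left of \<open>s\<close> reduces the tail to a proper
    integral with moving upper limit.\<close>
  let ?a = "s - 1" and ?b = "s + 1"
  have split: "powr_tail r = powr_tail ?a - integral {?a..r} powr_kernel" if "r \<in> {?a..?b}" for r
  proof -
    have "(powr_kernel has_integral integral {?a..r} powr_kernel) {?a..r}"
      using powr_kernel_continuous by (intro integrable_integral integrable_continuous_real)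
    moreover have "(powr_kernel has_integral powr_tail r) {r..}"
      unfolding powr_tail_eq using powr_kernel_integrable(1) set_lebesgue_integral_eq_integral(1)
      by (intro integrable_integral) blast
    ultimately have "(powr_kernel has_integral integral {?a..r} powr_kernel + powr_tail r) ({?a..r} \<union> {r..})"
      by (rule has_integral_Un) (rule negligible_subset[of "{r}"], auto)
    moreover have "{?a..r} \<union> {r..} = {?a..}" using that by auto
    ultimately show ?thesis by (simp add: powr_tail_eq integral_unique)
  qed
  have "((\<lambda>r. integral {?a..r} powr_kernel) has_real_derivative powr_kernel s) (at s within {?a..?b})"
    by (rule integral_has_real_derivative[OF powr_kernel_continuous]) simp
  then have "((\<lambda>r. integral {?a..r} powr_kernel) has_real_derivative powr_kernel s) (at s)"
    by (simp add: at_within_Icc_at)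
  then have "((\<lambda>r. powr_tail ?a - integral {?a..r} powr_kernel) has_real_derivative - powr_kernel s) (at s)"
    by (auto intro!: derivative_eq_intros)
  moreover have "\<forall>\<^sub>F r in nhds s. powr_tail ?a - integral {?a..r} powr_kernel = powr_tail r"
    by (rule eventually_mono[OF eventually_nhds_in_open[of "{?a<..<?b}" s]])
      (auto intro!: split[symmetric])
  ultimately show ?thesis
    by (rule DERIV_cong_ev[OF refl _ refl, THEN iffD1, rotated])
qed

lemma powr_tail_tendsto: "(powr_tail \<longlongrightarrow> 0) at_top"
proof (rule Lim_null_comparison)
  let ?c = "1 / (2 * \<xi>)"
  \<comment> \<open>Taking the base point 0 in \<open>powr_kernel_bound\<close> gives one constant
    for all tails with \<open>s \<ge> 0\<close>.\<close>
  let ?M = "1 + \<bar>0\<bar> + 1 / ?c"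
  show "\<forall>\<^sub>F s in at_top. norm (powr_tail s) \<le> ?M * (exp (- ?c * s) / ?c)"
    using eventually_ge_at_top[of 0]
  proof eventually_elim
    case (elim s)
    have "norm (powr_tail s) \<le> integral {s..} (\<lambda>r. ?M * exp (- ?c * r))"
      unfolding powr_tail_eq
    proof (rule integral_norm_bound_integral)
      show "powr_kernel integrable_on {s..}"
        using powr_kernel_integrable(1) set_lebesgue_integral_eq_integral(1) by blast
      show "(\<lambda>r. ?M * exp (- ?c * r)) integrable_on {s..}" by (rule powr_kernel_integrable(2))
      show "norm (powr_kernel r) \<le> ?M * exp (- ?c * r)" if "r \<in> {s..}" for r
        using powr_kernel_bound[of 0 r] that elim by simp
    qed
    also have "\<dots> = ?M * (exp (- ?c * s) / ?c)"
      using has_integral_mult_right[OF has_integral_exp_minus_to_infinity[of ?c s], of ?M] \<xi>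
      by (intro integral_unique) simp
    finally show ?case .
  qed
  have "((\<lambda>s. M * (exp (- c * s) / c)) \<longlongrightarrow> 0) at_top" if "c > 0" for c M :: real
    using that by real_asymp
  from this[of ?c ?M] show "((\<lambda>s. ?M * (exp (- ?c * s) / ?c)) \<longlongrightarrow> 0) at_top"
    using \<xi> by (simp only: zero_less_divide_1_iff zero_less_mult_iff) simp
qed

text \<open>Variation of constants gives the solution \<open>exp y\<close> times the integral of
  \<open>exp (- z) * h z\<close> over \<open>z \<ge> y\<close>. One integration by parts and the
  substitution \<open>r = u + \<xi> * z\<close> turn it into this \<open>\<Phi>\<close>, with the
  integral of \<open>cand_b\<close>.\<close>

lemma powr_conditions:
  fixes u :: real
  defines "\<Phi> \<equiv> \<lambda>y. \<bar>u + \<xi> * y\<bar> powr p + p * exp ((u + \<xi> * y) / \<xi>) * powr_tail (u + \<xi> * y)"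
  shows "(\<Phi> has_real_derivative \<Phi> y - \<bar>u + \<xi> * y\<bar> powr p) (at y)"
    and "((\<lambda>y. exp (- y) * \<Phi> y) \<longlongrightarrow> 0) at_top"
proof -
  have s: "((\<lambda>y. u + \<xi> * y) has_real_derivative \<xi>) (at y)"
    by (auto intro!: derivative_eq_intros)
  let ?s = "u + \<xi> * y"
  have 1: "((\<lambda>y. \<bar>u + \<xi> * y\<bar> powr p) has_real_derivative p * (\<bar>?s\<bar> powr (p - 1) * sgn ?s) * \<xi>) (at y)"
    by (rule DERIV_chain2[OF powr_abs_deriv[OF p(1)] s])
  have 2: "((\<lambda>y. powr_tail (u + \<xi> * y)) has_real_derivative - powr_kernel ?s * \<xi>) (at y)"
    by (rule DERIV_chain2[OF powr_tail_deriv s])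
  have 3: "((\<lambda>y. exp ((u + \<xi> * y) / \<xi>)) has_real_derivative exp (?s / \<xi>)) (at y)"
    using \<xi> by (auto intro!: derivative_eq_intros)
  have k: "exp (?s / \<xi>) * powr_kernel ?s = \<bar>?s\<bar> powr (p - 1) * sgn ?s"
    by (simp add: powr_kernel_def mult_ac flip: exp_add) (simp flip: add_divide_distrib)
  have "(\<Phi> has_real_derivative p * (\<bar>?s\<bar> powr (p - 1) * sgn ?s) * \<xi>
      + (p * exp (?s / \<xi>) * powr_tail ?s + - powr_kernel ?s * \<xi> * (p * exp (?s / \<xi>)))) (at y)"
    unfolding \<Phi>_def by (rule DERIV_add[OF 1 DERIV_mult[OF DERIV_cmult[OF 3] 2]])
  moreover have "p * (\<bar>?s\<bar> powr (p - 1) * sgn ?s) * \<xi>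
      + (p * exp (?s / \<xi>) * powr_tail ?s + - powr_kernel ?s * \<xi> * (p * exp (?s / \<xi>)))
      = \<Phi> y - \<bar>?s\<bar> powr p"
    unfolding k[symmetric] \<Phi>_def by (simp add: mult_ac)
  ultimately show "(\<Phi> has_real_derivative \<Phi> y - \<bar>u + \<xi> * y\<bar> powr p) (at y)" by simp
  have "filterlim (\<lambda>y. u + \<xi> * y) at_top at_top" using \<xi> by real_asymp
  then have "((\<lambda>y. powr_tail (u + \<xi> * y)) \<longlongrightarrow> 0) at_top"
    by (rule filterlim_compose[OF powr_tail_tendsto])
  then have a: "((\<lambda>y. p * exp (u / \<xi>) * powr_tail (u + \<xi> * y)) \<longlongrightarrow> p * exp (u / \<xi>) * 0) at_top"
    by (intro tendsto_intros)
  have b: "((\<lambda>y. exp (- y) * \<bar>u + \<xi> * y\<bar> powr p) \<longlongrightarrow> 0) at_top" using \<xi> p by real_asymp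
  have "exp (- y) * \<Phi> y = exp (- y) * \<bar>u + \<xi> * y\<bar> powr p + p * exp (u / \<xi>) * powr_tail (u + \<xi> * y)" for y
  proof -
    have "exp (- y) * exp ((u + \<xi> * y) / \<xi>) = exp (u / \<xi>)"
    proof -
      have "- y + (u + \<xi> * y) / \<xi> = u / \<xi>" using \<xi> by (simp add: field_simps)
      then show ?thesis by (simp only: exp_add[symmetric])
    qed
    moreover have "exp (- y) * \<Phi> y = exp (- y) * \<bar>u + \<xi> * y\<bar> powr p
        + p * (exp (- y) * exp ((u + \<xi> * y) / \<xi>)) * powr_tail (u + \<xi> * y)"
      unfolding \<Phi>_def by (simp only: distrib_left mult_ac)
    ultimately show ?thesis by simp
  qed
  then show "((\<lambda>y. exp (- y) * \<Phi> y) \<longlongrightarrow> 0) at_top"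
    using tendsto_add[OF b a] by simp
qed

end

section \<open>Averages below the arc\<close>

lemma exp_ge_tangent: "exp m * (1 + (x - m)) \<le> exp (x::real)"
  using mult_left_mono[OF exp_ge_add_one_self[of "x - m"], of "exp m"] by (simp flip: exp_add)

text \<open>Jensen's inequality for lengths \<open>p\<close>, \<open>q\<close> and integrals
  \<open>x\<close>, \<open>y\<close>: tangents to \<open>exp\<close> at the common mean, whose
  linear terms cancel.\<close>

lemma exp_convex_perspective:
  fixes p q x y :: real
  assumes "0 < p" "0 < q"
  shows "(p + q) * exp ((x + y) / (p + q)) \<le> p * exp (x / p) + q * exp (y / q)"
proof -
  let ?m = "(x + y) / (p + q)"
  have "p * exp (x / p) \<ge> p * (exp ?m * (1 + (x / p - ?m)))"
    using assms by (intro mult_left_mono exp_ge_tangent) auto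
  moreover have "q * exp (y / q) \<ge> q * (exp ?m * (1 + (y / q - ?m)))"
    using assms by (intro mult_left_mono exp_ge_tangent) auto
  moreover have "p * (exp ?m * (1 + (x / p - ?m))) + q * (exp ?m * (1 + (y / q - ?m))) = (p + q) * exp ?m"
  proof -
    have "p * (exp ?m * (1 + (x / p - ?m))) + q * (exp ?m * (1 + (y / q - ?m))) =
        exp ?m * ((p + q) + (p * (x / p) + q * (y / q)) - (p + q) * ?m)"
      by (simp only: algebra_simps)
    also have "p * (x / p) + q * (y / q) = (p + q) * ?m" using assms by simp
    finally show ?thesis by simp
  qed
  ultimately show ?thesis by linarith
qed

text \<open>Here \<open>x\<close>, \<open>y\<close> stand for integrals of \<open>\<phi>\<close>,
  and \<open>x'\<close>, \<open>y'\<close> for integrals of \<open>exp \<circ> \<phi>\<close>, over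
  pieces of length \<open>p\<close> and \<open>q\<close>.\<close>

lemma remove_above_arc:
  fixes C p q x y x' y' :: real
  assumes "0 < p" "0 < q" "0 < C"
    and "C * p * exp (x / p) \<le> x'"
    and "x' + y' \<le> C * (p + q) * exp ((x + y) / (p + q))"
  shows "y' \<le> C * q * exp (y / q)"
proof -
  have "C * ((p + q) * exp ((x + y) / (p + q))) \<le> C * (p * exp (x / p) + q * exp (y / q))"
    using exp_convex_perspective[OF assms(1,2)] assms(3) by (intro mult_left_mono) auto
  then show ?thesis using assms(4,5) by (simp add: algebra_simps)
qed

text \<open>The tangent to the upper boundary arc through \<open>(\<nu>, exp \<nu>)\<close> is
  \<open>y = exp \<nu> * (1 + (x - \<nu>) / (1 - \<xi>))\<close>; \<open>gap\<close> measures the height above it of the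
  integral over \<open>[0, t]\<close>, without dividing by \<open>t\<close>.\<close>

definition gap :: "real \<Rightarrow> real \<Rightarrow> (real \<Rightarrow> real) \<Rightarrow> (real \<Rightarrow> real) \<Rightarrow> real \<Rightarrow> real" where
  "gap \<xi> \<nu> F G t = G t - exp \<nu> * (t * (1 - \<nu> / (1 - \<xi>)) + F t / (1 - \<xi>))"

text \<open>The sign of \<open>\<xi>\<close> is left open, so that both roots are instances.\<close>

locale tangent =
  fixes C \<xi> :: real
  assumes C: "0 < C" and \<xi>: "\<xi> < 1" "exp (- \<xi>) = C * (1 - \<xi>)"
begin

text \<open>The inequality \<open>1 + z \<le> exp z\<close> with
  \<open>z = y - \<nu> - \<xi>\<close>, the distance from the point of tangency.\<close>

lemma tangent_le_arc: "exp \<nu> * (1 + (y - \<nu>) / (1 - \<xi>)) \<le> C * exp y"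
proof -
  have "1 + (y - \<nu> - \<xi>) \<le> exp (y - \<nu> - \<xi>)" by (rule exp_ge_add_one_self)
  also have "\<dots> = exp (y - \<nu>) * (C * (1 - \<xi>))" by (simp flip: \<xi>(2) exp_add)
  finally have "1 + (y - \<nu>) / (1 - \<xi>) \<le> C * exp (y - \<nu>)" using \<xi>(1) by (simp add: field_simps)
  then have "exp \<nu> * (1 + (y - \<nu>) / (1 - \<xi>)) \<le> exp \<nu> * (C * exp (y - \<nu>))" by (intro mult_left_mono) auto
  also have "\<dots> = C * exp y" by (simp add: exp_diff)
  finally show ?thesis .
qed

text \<open>\<open>gap\<close> is linear in the integrals, so its increment is \<open>t - s\<close>
  times the height above the tangent of the averages over \<open>[s, t]\<close>.\<close>

lemma below_arcI:
  assumes "s < t" "gap \<xi> \<nu> F G t \<le> gap \<xi> \<nu> F G s"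
  shows "below_arc C F G s t"
proof -
  let ?q = "t - s" and ?z = "F t - F s"
  have q: "?q > 0" using assms by simp
  have "G t - G s \<le> exp \<nu> * (?q * (1 - \<nu> / (1 - \<xi>)) + ?z / (1 - \<xi>))"
    using assms(2) by (simp add: gap_def algebra_simps diff_divide_distrib)
  also have "\<dots> = ?q * (exp \<nu> * (1 + (?z / ?q - \<nu>) / (1 - \<xi>)))"
  proof -
    have "?q * (1 - \<nu> / (1 - \<xi>)) + ?z / (1 - \<xi>) = ?q * (1 + (?z / ?q - \<nu>) / (1 - \<xi>))"
    proof -
      have "r * (1 - \<nu> / e) + z / e = r * (1 + (z / r - \<nu>) / e)" if "r > 0" "e > 0" for r z e
        using that by (simp add: field_simps)
      then show ?thesis using q \<xi>(1) by simp
    qed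
    then show ?thesis by simp
  qed
  also have "\<dots> \<le> ?q * (C * exp (?z / ?q))"
    using q by (intro mult_left_mono tangent_le_arc) auto
  finally show ?thesis by (simp add: below_arc_def mult_ac)
qed

lemma gap_log_nonneg:
  assumes "0 \<le> s" "s \<le> \<alpha>"
  shows "0 \<le> gap \<xi> \<nu> (logF u \<xi> \<alpha>) (logG u \<xi> \<alpha>) s"
proof -
  define y where "y = u + \<xi> * ln (\<alpha> / s)"
  have "gap \<xi> \<nu> (logF u \<xi> \<alpha>) (logG u \<xi> \<alpha>) s
      = s / (1 - \<xi>) * (exp y - exp \<nu> * (1 + (y - \<nu>)))"
  proof -
    have "logF u \<xi> \<alpha> s = s * (y + \<xi>)" "logG u \<xi> \<alpha> s = s * (exp y / (1 - \<xi>))"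
      using assms by (simp_all add: logprim_def y_def)
    moreover have "s * (E / e) - N * (s * (1 - \<nu> / e) + s * (y + (1 - e)) / e)
        = s / e * (E - N * (1 + (y - \<nu>)))" if "e > 0" for e E N
      using that by (simp add: field_simps)
    from this[of "1 - \<xi>" "exp y" "exp \<nu>"] have
      "s * (exp y / (1 - \<xi>)) - exp \<nu> * (s * (1 - \<nu> / (1 - \<xi>)) + s * (y + \<xi>) / (1 - \<xi>))
        = s / (1 - \<xi>) * (exp y - exp \<nu> * (1 + (y - \<nu>)))"
      using \<xi>(1) by simp
    ultimately show ?thesis by (simp only: gap_def)
  qed
  moreover have "exp \<nu> * (1 + (y - \<nu>)) \<le> exp y" by (rule exp_ge_tangent)
  ultimately show ?thesis using assms \<xi>(1) by simp
qed

text \<open>Up to \<open>\<alpha>\<close> the average over \<open>(0, t)\<close> is the tangency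
  point itself; beyond \<open>\<alpha>\<close> it moves along a fixed tangent towards
  \<open>(u, exp u)\<close>.\<close>

lemma gap_log_eq_0:
  assumes "0 \<le> t"
  shows "gap \<xi> (u + \<xi> * logplus \<alpha> t) (logF u \<xi> \<alpha>) (logG u \<xi> \<alpha>) t = 0"
proof (cases "t \<le> \<alpha>")
  case True
  have "t * (E / e) - E * (t * (1 - y / e) + t * (y + (1 - e)) / e) = 0" if "e > 0" for e E y
    using that by (simp add: field_simps)
  from this[of "1 - \<xi>" "exp (u + \<xi> * ln (\<alpha> / t))" "u + \<xi> * ln (\<alpha> / t)"] show ?thesis
    using True \<xi>(1) by (simp add: gap_def logprim_def logplus_def algebra_simps)
next
  case False
  have "E * t + \<alpha> * (E / e - E) - E * (t * (1 - u / e) + (u * t + \<alpha> * (1 - e)) / e) = 0" if "e > 0" for e E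
    using that by (simp add: field_simps)
  from this[of "1 - \<xi>" "exp u"] show ?thesis
    using False \<xi>(1) by (simp add: gap_def logprim_def logplus_def)
qed

lemma below_arc_log:
  assumes "0 \<le> s" "s < t"
  shows "below_arc C (logF u \<xi> \<alpha>) (logG u \<xi> \<alpha>) s t"
proof (rule below_arcI[where \<nu> = "u + \<xi> * logplus \<alpha> t"])
  have "0 \<le> gap \<xi> (u + \<xi> * logplus \<alpha> t) (logF u \<xi> \<alpha>) (logG u \<xi> \<alpha>) s"
  proof (cases "s \<le> \<alpha>")
    case True
    then show ?thesis using gap_log_nonneg assms by blast
  next
    case False
    then have "logplus \<alpha> t = logplus \<alpha> s" using assms by (simp add: logplus_def)
    then show ?thesis using gap_log_eq_0[OF assms(1)] by simp
  qed
  then show "gap \<xi> (u + \<xi> * logplus \<alpha> t) (logF u \<xi> \<alpha>) (logG u \<xi> \<alpha>) t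
      \<le> gap \<xi> (u + \<xi> * logplus \<alpha> t) (logF u \<xi> \<alpha>) (logG u \<xi> \<alpha>) s"
    using gap_log_eq_0 assms by simp
qed (use assms in simp)

lemma log_on_arc:
  assumes "0 < s" "s \<le> \<alpha>"
  shows "C * s * exp (logF u \<xi> \<alpha> s / s) = logG u \<xi> \<alpha> s"
proof -
  have "C * exp \<xi> = 1 / (1 - \<xi>)" using \<xi> by (simp add: exp_minus field_simps)
  moreover have "logF u \<xi> \<alpha> s / s = \<xi> + (u + \<xi> * ln (\<alpha> / s))"
    using assms by (simp add: logprim_def)
  then have "C * s * exp (logF u \<xi> \<alpha> s / s) = s * (C * exp \<xi>) * exp (u + \<xi> * ln (\<alpha> / s))"
    by (simp only: exp_add mult_ac)
  ultimately show ?thesis using assms by (simp add: logprim_def)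
qed

lemma extremal_log:
  assumes "a < b" "{a<..<b} \<subseteq> Q" "Q \<subseteq> {a..b}" and \<alpha>: "0 \<le> \<alpha>" "\<alpha> \<le> 1"
  shows "extremal C Q a b (\<lambda>t. u + \<xi> * logplus \<alpha> t) (logF u \<xi> \<alpha>) (logG u \<xi> \<alpha>)"
proof
  show "primitive_on 0 1 (logF u \<xi> \<alpha>) (\<lambda>t. u + \<xi> * logplus \<alpha> t)"
    using primitive_on_logplus[OF \<alpha> logF_conditions, of u \<xi>] by simp
  show "primitive_on 0 1 (logG u \<xi> \<alpha>) (\<lambda>t. exp (u + \<xi> * logplus \<alpha> t))"
    using primitive_on_logplus[OF \<alpha> logG_conditions[OF \<xi>(1)], of u] by simp
qed (use assms below_arc_log in auto)

end

lemma extremal_const: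
  assumes "a < b" "{a<..<b} \<subseteq> Q" "Q \<subseteq> {a..b}" "1 \<le> C"
  shows "extremal C Q a b (\<lambda>t. c) (\<lambda>t. c * t) (\<lambda>t. exp c * t)"
proof
  show "primitive_on 0 1 (\<lambda>t. c * t) (\<lambda>t. c)" "primitive_on 0 1 (\<lambda>t. exp c * t) (\<lambda>t. exp c)"
    using primitive_on_const[of 0 1 _ 0] by simp_all
  show "below_arc C (\<lambda>t. c * t) (\<lambda>t. exp c * t) s t" if "s < t" for s t
  proof -
    have "(c * t - c * s) / (t - s) = c" using that by (simp add: field_simps)
    then show ?thesis using that assms(4) mult_right_mono[of 1 C "(t - s) * exp c"]
      by (simp add: below_arc_def algebra_simps)
  qed
qed (use assms in auto)

section \<open>The implicit functions\<close>

lemma one_minus_mult_exp_deriv: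
  "((\<lambda>x::real. (1 - x) * exp x) has_real_derivative - x * exp x) (at x)"
  by (auto intro!: derivative_eq_intros simp: algebra_simps)

lemma one_minus_mult_exp_anti:
  assumes "0 \<le> x" "x < y" shows "(1 - y) * exp y < (1 - x) * exp (x::real)"
  by (rule DERIV_neg_imp_decreasing_open[OF assms(2)])
    (use assms one_minus_mult_exp_deriv in \<open>force intro!: continuous_intros\<close>)+

lemma one_minus_mult_exp_mono:
  assumes "x < y" "y \<le> 0" shows "(1 - x) * exp x < (1 - y) * exp (y::real)"
  by (rule DERIV_pos_imp_increasing_open[OF assms(1)])
    (use assms one_minus_mult_exp_deriv in \<open>force intro!: continuous_intros simp: mult_neg_pos\<close>)+

lemma xi_equation_iff: "C \<noteq> 0 \<Longrightarrow> exp (- x) = C * (1 - x) \<longleftrightarrow> (1 - x) * exp x = 1 / (C::real)"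
  by (auto simp: exp_minus field_simps)

lemma xi_plus_props:
  assumes "1 < C"
  shows "0 < xi_plus C" "xi_plus C < 1" "exp (- xi_plus C) = C * (1 - xi_plus C)"
proof -
  have "\<exists>x\<ge>0. x \<le> 1 \<and> (1 - x) * exp x = 1 / C"
    by (rule IVT2') (use assms in \<open>auto intro!: continuous_intros\<close>)
  then obtain x where x: "0 \<le> x" "x \<le> 1" "(1 - x) * exp x = 1 / C" by blast
  have x1: "x < 1" using x assms by (cases "x = 1") auto
  have "xi_plus C = x"
    unfolding xi_plus_def
  proof (rule the_equality)
    fix y assume y: "0 \<le> y \<and> y < 1 \<and> exp (- y) = C * (1 - y)"
    then have "(1 - y) * exp y = 1 / C" using xi_equation_iff assms by auto
    then show "y = x"
      using one_minus_mult_exp_anti[of x y] one_minus_mult_exp_anti[of y x] x y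
      by (cases x y rule: linorder_cases) auto
  qed (use x x1 assms xi_equation_iff in auto)
  moreover have "x \<noteq> 0" using x assms by auto
  ultimately show "0 < xi_plus C" "xi_plus C < 1" "exp (- xi_plus C) = C * (1 - xi_plus C)"
    using x x1 assms xi_equation_iff[of C x] by auto
qed

lemma xi_minus_props:
  assumes "1 < C"
  shows "xi_minus C < 0" "exp (- xi_minus C) = C * (1 - xi_minus C)"
proof -
  \<comment> \<open>The intermediate value theorem needs an explicit point where
    \<open>(1 - x) * exp x \<le> 1 / C\<close>; \<open>- 8 * C\<close> is one.\<close>
  have "C * (1 + 8 * C) \<le> (1 + 4 * C) * (1 + 4 * C)" using assms by (simp add: algebra_simps)
  also have "\<dots> \<le> exp (4 * C) * exp (4 * C)"
    using exp_ge_add_one_self[of "4 * C"] assms by (intro mult_mono) auto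
  also have "\<dots> = exp (8 * C)" by (simp flip: exp_add)
  finally have "(1 - - 8 * C) * exp (- 8 * C) \<le> 1 / C"
    using assms by (simp add: exp_minus divide_simps mult_ac)
  then have "\<exists>x\<ge>- 8 * C. x \<le> 0 \<and> (1 - x) * exp x = 1 / C"
    by (intro IVT') (use assms in \<open>auto intro!: continuous_intros\<close>)
  then obtain x where x: "x \<le> 0" "(1 - x) * exp x = 1 / C" by blast
  have "xi_minus C = x"
    unfolding xi_minus_def
  proof (rule the_equality)
    fix y assume y: "y \<le> 0 \<and> exp (- y) = C * (1 - y)"
    then have "(1 - y) * exp y = 1 / C" using xi_equation_iff assms by auto
    then show "y = x"
      using one_minus_mult_exp_mono[of x y] one_minus_mult_exp_mono[of y x] x y
      by (cases x y rule: linorder_cases) auto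
  qed (use x assms xi_equation_iff in auto)
  moreover have "x \<noteq> 0" using x assms by auto
  ultimately show "xi_minus C < 0" "exp (- xi_minus C) = C * (1 - xi_minus C)"
    using x assms xi_equation_iff[of C x] by auto
qed

text \<open>Second coordinate, over \<open>x\<close>, of the tangent to the arc through \<open>(u, exp u)\<close>.\<close>

definition height :: "real \<Rightarrow> real \<Rightarrow> real \<Rightarrow> real" where
  "height \<xi> x u = exp u * ((x - u) / (1 - \<xi>) + 1)"

context tangent
begin

text \<open>The sign changes at \<open>u = x - \<xi>\<close>, where the tangent touches over
  \<open>x\<close>. The range of \<open>u_plus\<close> lies to the right of this point, that of
  \<open>u_minus\<close> to the left.\<close>

lemma height_deriv: "(height \<xi> x has_real_derivative exp u * (x - u - \<xi>) / (1 - \<xi>)) (at u)"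
proof -
  have "((\<lambda>u. exp u * ((x - u) / e + 1)) has_real_derivative exp u * (x - u - (1 - e)) / e) (at u)"
    if "e > 0" for e
    using that by (auto intro!: derivative_eq_intros simp: field_simps)
  from this[of "1 - \<xi>"] show ?thesis using \<xi>(1) by (simp add: height_def[abs_def])
qed

lemma height_continuous: "continuous_on S (height \<xi> x)"
  unfolding height_def[abs_def] using \<xi>(1) by (auto intro!: continuous_intros)

lemma height_anti:
  assumes "x - \<xi> \<le> u" "u < w" shows "height \<xi> x w < height \<xi> x u"
proof (rule DERIV_neg_imp_decreasing_open[OF assms(2) _ height_continuous])
  fix v assume "u < v" "v < w"
  then have "exp v * (x - v - \<xi>) / (1 - \<xi>) < 0"
    using assms \<xi>(1) by (intro divide_neg_pos mult_pos_neg) auto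
  then show "\<exists>y. (height \<xi> x has_real_derivative y) (at v) \<and> y < 0" using height_deriv by blast
qed

lemma height_mono:
  assumes "u < w" "w \<le> x - \<xi>" shows "height \<xi> x u < height \<xi> x w"
proof (rule DERIV_pos_imp_increasing_open[OF assms(1) _ height_continuous])
  fix v assume "u < v" "v < w"
  then have "0 < exp v * (x - v - \<xi>) / (1 - \<xi>)"
    using assms \<xi>(1) by (intro divide_pos_pos mult_pos_pos) auto
  then show "\<exists>y. (height \<xi> x has_real_derivative y) (at v) \<and> 0 < y" using height_deriv by blast
qed

lemma height_ends: "height \<xi> x x = exp x" "height \<xi> x (x - \<xi>) = C * exp x"
proof -
  have "\<xi> / (1 - \<xi>) + 1 = 1 / (1 - \<xi>)" using \<xi>(1) by (simp add: field_simps)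
  moreover have "exp (x - \<xi>) = exp x * (C * (1 - \<xi>))" by (simp flip: \<xi>(2) exp_add)
  ultimately show "height \<xi> x (x - \<xi>) = C * exp x" using \<xi>(1) by (simp add: height_def)
qed (simp add: height_def)

end

section \<open>The two tangents through a point of \<open>Omega C\<close>\<close>

locale arc =
  fixes C :: real
  assumes C1: "1 < C"
begin

abbreviation "p \<equiv> xi_plus C"
abbreviation "m \<equiv> xi_minus C"

lemmas p = xi_plus_props[OF C1]
lemmas m = xi_minus_props[OF C1]

lemma tangent_p: "tangent C p" and tangent_m: "tangent C m"
  using C1 p m by unfold_locales auto

lemmas P_below_arcI = tangent.below_arcI[OF tangent_p]
  and P_below_arc_log = tangent.below_arc_log[OF tangent_p]
  and P_extremal_log = tangent.extremal_log[OF tangent_p]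
  and P_gap_log_eq_0 = tangent.gap_log_eq_0[OF tangent_p]
  and P_gap_log_nonneg = tangent.gap_log_nonneg[OF tangent_p]
  and P_height_anti = tangent.height_anti[OF tangent_p]
  and P_height_continuous = tangent.height_continuous[OF tangent_p]
  and P_height_ends = tangent.height_ends[OF tangent_p]
  and P_log_on_arc = tangent.log_on_arc[OF tangent_p]

lemmas M_below_arc_log = tangent.below_arc_log[OF tangent_m]
  and M_extremal_log = tangent.extremal_log[OF tangent_m]
  and M_height_continuous = tangent.height_continuous[OF tangent_m]
  and M_height_ends = tangent.height_ends[OF tangent_m]
  and M_height_mono = tangent.height_mono[OF tangent_m]
  and M_log_on_arc = tangent.log_on_arc[OF tangent_m]

lemma u_plus_props:
  assumes "x \<in> Omega C"
  shows "fst x - p \<le> u_plus C x" "u_plus C x \<le> fst x" "snd x = height p (fst x) (u_plus C x)"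
proof -
  have x: "exp (fst x) \<le> snd x" "snd x \<le> C * exp (fst x)" using assms by (auto simp: Omega_def)
  have "\<exists>u\<ge>fst x - p. u \<le> fst x \<and> height p (fst x) u = snd x"
    by (rule IVT2') (use x p P_height_ends P_height_continuous in auto)
  then obtain u where u: "fst x - p \<le> u" "u \<le> fst x" "height p (fst x) u = snd x" by blast
  have "u_plus C x = u"
    unfolding u_plus_def height_def[symmetric]
  proof (rule the_equality)
    fix w assume w: "fst x - p \<le> w \<and> w \<le> fst x \<and> snd x = height p (fst x) w"
    then show "w = u"
      using P_height_anti[of "fst x" u w] P_height_anti[of "fst x" w u] u
      by (cases u w rule: linorder_cases) auto
  qed (use u in auto)
  then show "fst x - p \<le> u_plus C x" "u_plus C x \<le> fst x" "snd x = height p (fst x) (u_plus C x)"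
    using u by auto
qed

lemma u_minus_props:
  assumes "x \<in> Omega C"
  shows "fst x \<le> u_minus C x" "u_minus C x \<le> fst x - m" "snd x = height m (fst x) (u_minus C x)"
proof -
  have x: "exp (fst x) \<le> snd x" "snd x \<le> C * exp (fst x)" using assms by (auto simp: Omega_def)
  have "\<exists>u\<ge>fst x. u \<le> fst x - m \<and> height m (fst x) u = snd x"
    by (rule IVT') (use x m M_height_ends M_height_continuous in auto)
  then obtain u where u: "fst x \<le> u" "u \<le> fst x - m" "height m (fst x) u = snd x" by blast
  have "u_minus C x = u"
    unfolding u_minus_def height_def[symmetric]
  proof (rule the_equality)
    fix w assume w: "fst x \<le> w \<and> w \<le> fst x - m \<and> snd x = height m (fst x) w"
    then show "w = u"
      using M_height_mono[of u w "fst x"] M_height_mono[of w u "fst x"] u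
      by (cases u w rule: linorder_cases) auto
  qed (use u in auto)
  then show "fst x \<le> u_minus C x" "u_minus C x \<le> fst x - m" "snd x = height m (fst x) (u_minus C x)"
    using u by auto
qed

text \<open>Straight borders of the regions are tangents through a fixed \<open>(c, exp c)\<close>;
  monotonicity of \<open>height\<close> turns the side on which \<open>x\<close> lies into a bound
  on \<open>u\<close>.\<close>

lemma le_u_plus:
  assumes "x \<in> Omega C" "fst x - p \<le> c" "snd x \<le> height p (fst x) c"
  shows "c \<le> u_plus C x"
  using P_height_anti[of "fst x" "u_plus C x" c] u_plus_props[OF assms(1)] assms(2,3) by force

lemma u_plus_le:
  assumes "x \<in> Omega C" "fst x - p \<le> c" "height p (fst x) c \<le> snd x"
  shows "u_plus C x \<le> c"
  using P_height_anti[of "fst x" c "u_plus C x"] u_plus_props[OF assms(1)] assms(2,3) by force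

lemma u_minus_le:
  assumes "x \<in> Omega C" "c \<le> fst x - m" "snd x \<le> height m (fst x) c"
  shows "u_minus C x \<le> c"
  using M_height_mono[of c "u_minus C x" "fst x"] u_minus_props[OF assms(1)] assms(2,3) by force

lemma C_exp_p: "C * exp p = 1 / (1 - p)" and C_exp_m: "C * exp m = 1 / (1 - m)"
  using p m by (auto simp: exp_minus field_simps)

lemma exp_p_minus_m: "exp (p - m) = 1 + (p - m) / (1 - p)"
proof -
  have "exp (p - m) = exp (- m) / exp (- p)" by (simp add: exp_minus exp_diff field_simps)
  also have "\<dots> = (1 - m) / (1 - p)" using p m C1 by simp
  finally show ?thesis using p by (simp add: field_simps)
qed

text \<open>\<open>\<alpha>\<close> is the ratio in which \<open>x\<close> divides the segment from
  \<open>(u, exp u)\<close> to its tangency point over \<open>u + p\<close>.\<close>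

lemma extremal_plus:
  assumes "x \<in> Omega C" and Q: "a < b" "{a<..<b} \<subseteq> Q" "Q \<subseteq> {a..b}"
  defines "u \<equiv> u_plus C x"
  defines "\<alpha> \<equiv> (fst x - u) / p"
  shows "0 \<le> \<alpha>" "\<alpha> \<le> 1"
    "extremal C Q a b (\<lambda>t. u + p * logplus \<alpha> t) (logF u p \<alpha>) (logG u p \<alpha>)"
    "(logF u p \<alpha> 1 - logF u p \<alpha> 0, logG u p \<alpha> 1 - logG u p \<alpha> 0) = x"
proof -
  note u = u_plus_props[OF assms(1), folded u_def]
  show \<alpha>: "0 \<le> \<alpha>" "\<alpha> \<le> 1" unfolding \<alpha>_def using u p by (auto simp: divide_simps)
  show "extremal C Q a b (\<lambda>t. u + p * logplus \<alpha> t) (logF u p \<alpha>) (logG u p \<alpha>)"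
    by (rule P_extremal_log[OF Q \<alpha>])
  have ap: "\<alpha> * p = fst x - u" using p by (simp add: \<alpha>_def)
  have "snd x = exp u * (\<alpha> * p / (1 - p) + 1)" using u by (simp add: height_def ap)
  also have "\<dots> = exp u + \<alpha> * (exp u / (1 - p) - exp u)" using p by (simp add: field_simps)
  finally show "(logF u p \<alpha> 1 - logF u p \<alpha> 0, logG u p \<alpha> 1 - logG u p \<alpha> 0) = x"
    using \<alpha> ap by (simp add: logprim_0 logprim_1 prod_eq_iff algebra_simps)
qed

lemma extremal_minus:
  assumes "x \<in> Omega C" and Q: "a < b" "{a<..<b} \<subseteq> Q" "Q \<subseteq> {a..b}"
  defines "u \<equiv> u_minus C x"
  defines "\<alpha> \<equiv> (fst x - u) / m"
  shows "0 \<le> \<alpha>" "\<alpha> \<le> 1"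
    "extremal C Q a b (\<lambda>t. u + m * logplus \<alpha> t) (logF u m \<alpha>) (logG u m \<alpha>)"
    "(logF u m \<alpha> 1 - logF u m \<alpha> 0, logG u m \<alpha> 1 - logG u m \<alpha> 0) = x"
proof -
  note u = u_minus_props[OF assms(1), folded u_def]
  show \<alpha>: "0 \<le> \<alpha>" "\<alpha> \<le> 1" unfolding \<alpha>_def using u m by (auto simp: divide_simps)
  show "extremal C Q a b (\<lambda>t. u + m * logplus \<alpha> t) (logF u m \<alpha>) (logG u m \<alpha>)"
    by (rule M_extremal_log[OF Q \<alpha>])
  have ap: "\<alpha> * m = fst x - u" using m by (simp add: \<alpha>_def)
  have "snd x = exp u * (\<alpha> * m / (1 - m) + 1)" using u by (simp add: height_def ap)
  also have "\<dots> = exp u + \<alpha> * (exp u / (1 - m) - exp u)" using m by (simp add: field_simps)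
  finally show "(logF u m \<alpha> 1 - logF u m \<alpha> 0, logG u m \<alpha> 1 - logG u m \<alpha> 0) = x"
    using \<alpha> ap by (simp add: logprim_0 logprim_1 prod_eq_iff algebra_simps)
qed

end

section \<open>Step functions\<close>

lemma logplus_nonneg: "0 < t \<Longrightarrow> 0 \<le> logplus \<alpha> t"
  by (simp add: logplus_def)

lemma primitive_on_add:
  assumes "primitive_on a b F f" "primitive_on a b G g"
  shows "primitive_on a b (\<lambda>t. F t + G t) (\<lambda>t. f t + g t)"
  unfolding primitive_on_def
proof clarify
  fix s t assume st: "a \<le> s" "s \<le> t" "t \<le> b"
  from has_integral_add[OF primitive_onD[OF assms(1) st] primitive_onD[OF assms(2) st]]
  show "((\<lambda>t. f t + g t) has_integral F t + G t - (F s + G s)) {s..t}"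
    by (simp add: algebra_simps)
qed

definition step_prim :: "real \<Rightarrow> real \<Rightarrow> real \<Rightarrow> real \<Rightarrow> real" where
  "step_prim c d \<beta> t = c * t + (d - c) * max 0 (t - \<beta>)"

lemma primitive_on_step:
  assumes "a \<le> \<beta>" "\<beta> \<le> b"
  shows "primitive_on a b (step_prim c d \<beta>) (\<lambda>t. if t \<le> \<beta> then c else d)"
proof -
  have "primitive_on a b (\<lambda>t. if t \<le> \<beta> then c * t + 0 else d * t + (c - d) * \<beta>) (\<lambda>t. if t \<le> \<beta> then c else d)"
    by (rule primitive_on_glue[OF primitive_on_const primitive_on_const]) (simp add: algebra_simps)
  moreover have "(\<lambda>t. if t \<le> \<beta> then c * t + 0 else d * t + (c - d) * \<beta>) = step_prim c d \<beta>"
    by (auto simp: fun_eq_iff step_prim_def max_def algebra_simps)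
  ultimately show ?thesis by simp
qed

lemma below_arc_cong:
  assumes "below_arc C F G s t" "F t - F s = F' t - F' s" "G t - G s = G' t - G' s"
  shows "below_arc C F' G' s t"
  using assms by (simp add: below_arc_def)

lemma below_arc_remove_left:
  assumes "0 < C" "r < s" "s < t" "below_arc C F G r t"
    and "C * (s - r) * exp ((F s - F r) / (s - r)) \<le> G s - G r"
  shows "below_arc C F G s t"
  using remove_above_arc[of "s - r" "t - s" C "F s - F r" "G s - G r" "G t - G s" "F t - F s"] assms
  by (simp add: below_arc_def)

lemma below_arc_remove_right:
  assumes "0 < C" "r < s" "s < t" "below_arc C F G r t"
    and "C * (t - s) * exp ((F t - F s) / (t - s)) \<le> G t - G s"
  shows "below_arc C F G r s"
  using remove_above_arc[of "t - s" "s - r" C "F t - F s" "G t - G s" "G s - G r" "F s - F r"] assms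
  by (simp add: below_arc_def)

context arc
begin

lemma exp_le_chord:
  assumes "0 \<le> y" "y \<le> p - m"
  shows "exp y \<le> 1 + y / (1 - p)"
proof -
  let ?d = "p - m"
  have d: "?d > 0" using p m by simp
  \<comment> \<open>Tangents to \<open>exp\<close> at \<open>y\<close>, evaluated at both ends of
    the chord, with weights that cancel the linear terms.\<close>
  have "(?d - y) * (exp y * (1 + (0 - y))) + y * (exp y * (1 + (?d - y))) \<le> (?d - y) * exp 0 + y * exp ?d"
    using assms by (intro add_mono mult_left_mono exp_ge_tangent) auto
  moreover have "(?d - y) * (exp y * (1 + (0 - y))) + y * (exp y * (1 + (?d - y))) = ?d * exp y"
    by (simp add: algebra_simps)
  moreover have "(?d - y) * exp 0 + y * exp ?d = ?d * (1 + y / (1 - p))"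
    unfolding exp_p_minus_m by (simp add: algebra_simps)
  ultimately show ?thesis using d by simp
qed

lemma exp_ge_chord:
  assumes "p - m \<le> y"
  shows "1 + y / (1 - p) \<le> exp y"
proof -
  \<comment> \<open>The chord slope \<open>1 / (1 - p)\<close> is at most the slope of
    \<open>exp\<close> at the right end of the chord.\<close>
  have "(y - (p - m)) * (1 / (1 - p)) \<le> (y - (p - m)) * exp (p - m)"
    using assms p m unfolding exp_p_minus_m by (intro mult_left_mono) (auto simp: field_simps)
  then have "1 + y / (1 - p) \<le> exp (p - m) * (1 + (y - (p - m)))"
    unfolding exp_p_minus_m using p by (simp add: algebra_simps add_divide_distrib diff_divide_distrib)
  then show ?thesis using exp_ge_tangent[of "p - m" y] by simp
qed

text \<open>Height of the lower boundary point over \<open>y\<close> above the tangent through \<open>(\<nu>, exp \<nu>)\<close>.\<close>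

definition excess :: "real \<Rightarrow> real \<Rightarrow> real" where
  "excess \<nu> y = exp y - exp \<nu> * (1 + (y - \<nu>) / (1 - p))"

lemma excess_nonpos: "\<nu> \<le> y \<Longrightarrow> y \<le> \<nu> + (p - m) \<Longrightarrow> excess \<nu> y \<le> 0"
  using mult_left_mono[OF exp_le_chord[of "y - \<nu>"], of "exp \<nu>"]
  by (simp add: excess_def flip: exp_add)

lemma excess_nonneg: "\<nu> + (p - m) \<le> y \<Longrightarrow> 0 \<le> excess \<nu> y"
  using mult_left_mono[OF exp_ge_chord[of "y - \<nu>"], of "exp \<nu>"]
  by (simp add: excess_def flip: exp_add)

lemma gap_step:
  "gap p \<nu> (step_prim c d \<beta>) (step_prim (exp c) (exp d) \<beta>) t
    = (t - max 0 (t - \<beta>)) * excess \<nu> c + max 0 (t - \<beta>) * excess \<nu> d"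
proof -
  have "E * t + (D - E) * w - N * (t * (1 - \<nu> / e) + (c * t + (d - c) * w) / e)
      = (t - w) * (E - N * (1 + (c - \<nu>) / e)) + w * (D - N * (1 + (d - \<nu>) / e))"
    for E D N w e by (simp add: algebra_simps add_divide_distrib diff_divide_distrib)
  then show ?thesis unfolding gap_def step_prim_def excess_def .
qed

text \<open>One tangent serves all subintervals: it is the chord of \<open>exp\<close> over
  \<open>[l - (p - m), l]\<close>, and the boundary points over both values are not above
  it.\<close>

lemma below_arc_step:
  assumes "s < t" "l - (p - m) \<le> v" "v \<le> l"
  shows "below_arc C (step_prim l v \<beta>) (step_prim (exp l) (exp v) \<beta>) s t"
proof (rule P_below_arcI[where \<nu> = "l - (p - m)", OF assms(1)])
  let ?\<nu> = "l - (p - m)" and ?w = "max 0 (t - \<beta>)" and ?w' = "max 0 (s - \<beta>)"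
  have d: "p - m > 0" using p m by simp
  have e: "excess ?\<nu> l \<le> 0" "excess ?\<nu> v \<le> 0" using excess_nonpos d assms by auto
  have "(t - ?w - (s - ?w')) * excess ?\<nu> l + (?w - ?w') * excess ?\<nu> v \<le> 0"
    using e assms(1) by (intro add_nonpos_nonpos mult_nonneg_nonpos) auto
  then show "gap p ?\<nu> (step_prim l v \<beta>) (step_prim (exp l) (exp v) \<beta>) t
    \<le> gap p ?\<nu> (step_prim l v \<beta>) (step_prim (exp l) (exp v) \<beta>) s"
    unfolding gap_step by (simp add: algebra_simps)
qed

text \<open>\<open>Omega_zero\<close>, shifted by \<open>(0, -1)\<close>, lies in the triangle spanned by the two tangents from its
  lowest point, since the chord between the two tangency points is above the arc.\<close>

lemma triangle_weights:
  assumes X: "m \<le> X" "X \<le> p" and Y: "X / (1 - m) \<le> Y" "X / (1 - p) \<le> Y" "1 + Y \<le> C * exp X"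
  obtains \<alpha> \<gamma> where "0 \<le> \<alpha>" "0 \<le> \<gamma>" "\<alpha> + \<gamma> \<le> 1"
    "X = \<alpha> * p + \<gamma> * m" "Y = \<alpha> * (p / (1 - p)) + \<gamma> * (m / (1 - m))"
proof -
  \<comment> \<open>\<open>e\<close> and \<open>f\<close> are the reciprocal slopes of the two
    tangents.\<close>
  define e where "e = 1 - p"
  define f where "f = 1 - m"
  have ef: "0 < e" "e < 1" "1 < f" "p = 1 - e" "m = 1 - f" using p m by (auto simp: e_def f_def)
  \<comment> \<open>Cramer's rule for the two linear equations to be solved.\<close>
  define \<alpha> where "\<alpha> = e * (Y * f - X) / ((1 - e) * (f - e))"
  define \<gamma> where "\<gamma> = f * (Y * e - X) / ((f - 1) * (f - e))"
  have a: "0 \<le> \<alpha>" "0 \<le> \<gamma>"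
    using Y(1,2) ef unfolding \<alpha>_def \<gamma>_def by (auto simp: divide_simps ef(4,5))
  have nz: "1 - e \<noteq> 0" "f - 1 \<noteq> 0" "f - e \<noteq> 0" "e \<noteq> 0" "f \<noteq> 0" using ef by auto
  have \<alpha>p: "\<alpha> * (1 - e) = e * (Y * f - X) / (f - e)" using nz by (simp add: \<alpha>_def)
  have \<gamma>m: "\<gamma> * (1 - f) = - (f * (Y * e - X) / (f - e))"
    using nz unfolding \<gamma>_def by (simp add: divide_simps) (simp add: algebra_simps)
  have X': "X = \<alpha> * (1 - e) + \<gamma> * (1 - f)"
  proof -
    have "e * (Y * f - X) / (f - e) + - (f * (Y * e - X) / (f - e)) = (f - e) * X / (f - e)"
      by (simp add: algebra_simps add_divide_distrib diff_divide_distrib)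
    then show ?thesis unfolding \<alpha>p \<gamma>m using nz by simp
  qed
  have Y': "Y = \<alpha> * ((1 - e) / e) + \<gamma> * ((1 - f) / f)"
  proof -
    have "\<alpha> * ((1 - e) / e) + \<gamma> * ((1 - f) / f) = (\<alpha> * (1 - e)) / e + (\<gamma> * (1 - f)) / f" by simp
    also have "\<dots> = (Y * f - X) / (f - e) - (Y * e - X) / (f - e)"
      unfolding \<alpha>p \<gamma>m using nz by simp
    also have "\<dots> = (f - e) * Y / (f - e)"
      by (simp add: algebra_simps add_divide_distrib diff_divide_distrib)
    also have "\<dots> = Y" using nz by simp
    finally show ?thesis by simp
  qed
  \<comment> \<open>After multiplication by \<open>C\<close>: the arc over \<open>X\<close> is below
    the chord joining its points over \<open>m\<close> and \<open>p\<close>.\<close>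
  have "(f - e) * exp X \<le> (p - X) * exp m + (X - m) * exp p"
  proof -
    have "(p - X) * (exp X * (1 + (m - X))) + (X - m) * (exp X * (1 + (p - X)))
        \<le> (p - X) * exp m + (X - m) * exp p"
      using X by (intro add_mono mult_left_mono exp_ge_tangent) auto
    moreover have "(p - X) * (exp X * (1 + (m - X))) + (X - m) * (exp X * (1 + (p - X))) = (f - e) * exp X"
      unfolding e_def f_def by (simp add: algebra_simps)
    ultimately show ?thesis by simp
  qed
  then have "C * ((f - e) * exp X) \<le> C * ((p - X) * exp m + (X - m) * exp p)"
    using C1 by (intro mult_left_mono) auto
  also have "\<dots> = (p - X) * (C * exp m) + (X - m) * (C * exp p)" by (simp add: algebra_simps)
  also have "\<dots> = (1 - e - X) / f + (X - (1 - f)) / e"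
    unfolding C_exp_m C_exp_p e_def f_def by simp
  finally have "(f - e) * (C * exp X) \<le> (1 - e - X) / f + (X - (1 - f)) / e"
    by (simp only: mult.left_commute)
  moreover have "(f - e) * (1 + Y) \<le> (f - e) * (C * exp X)"
    using Y(3) ef by (intro mult_left_mono) auto
  ultimately have "(f - e) * (1 + Y) \<le> (1 - e - X) / f + (X - (1 - f)) / e" by linarith
  \<comment> \<open>The factor of \<open>1 - \<alpha> - \<gamma>\<close> is \<open>f - e\<close>
    times the height of this chord above the vertex \<open>(0, 1)\<close>, hence positive.\<close>
  also have "\<dots> = (f - e) * (1 + Y) + (1 - \<alpha> - \<gamma>) * ((1 - e) / f + (f - 1) / e - (f - e))"
    unfolding X' Y' using nz by (simp add: field_simps)
  finally have 1: "0 \<le> (1 - \<alpha> - \<gamma>) * ((1 - e) / f + (f - 1) / e - (f - e))" by simp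
  have "(1 - e) / f + (f - 1) / e - (f - e) = (f - e) * ((1 - e) * (f - 1) / (e * f))"
    using nz by (simp add: field_simps)
  moreover have "0 < (f - e) * ((1 - e) * (f - 1) / (e * f))" using ef by simp
  ultimately have 2: "0 < (1 - e) / f + (f - 1) / e - (f - e)" by (simp only:)
  have "\<alpha> + \<gamma> \<le> 1" using mult_neg_pos[OF _ 2, of "1 - \<alpha> - \<gamma>"] 1 by linarith
  then show ?thesis using that[of \<alpha> \<gamma>] a X' Y' ef by simp
qed

end

section \<open>Extremals with one logarithm\<close>

lemma primitive_on_uminus:
  assumes "primitive_on a b F f" shows "primitive_on a b (\<lambda>t. - F t) (\<lambda>t. - f t)"
  unfolding primitive_on_def
proof clarify
  fix s t assume "a \<le> s" "s \<le> t" "t \<le> b"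
  from has_integral_neg[OF primitive_onD[OF assms this]]
  show "((\<lambda>t. - f t) has_integral - F t - - F s) {s..t}" by simp
qed

context arc
begin

context
  fixes x :: "real \<times> real" and Q :: "real set" and a b :: real
  assumes x: "x \<in> Omega C" and Q: "a < b" "{a<..<b} \<subseteq> Q" "Q \<subseteq> {a..b}"
begin

lemma bellman_b_powr:
  assumes "1 < q" "q \<le> 2"
  shows "bellman_b q C Q x \<le> ereal (cand_b q C x)"
proof -
  define u where "u = u_plus C x"
  define \<alpha> where "\<alpha> = (fst x - u) / p"
  note e = extremal_plus[OF x Q, folded u_def, folded \<alpha>_def]
  note H = primitive_on_logplus[OF e(1,2) powr_conditions[OF assms p(1), of u]]
  have "cand_b q C x = q * exp (u / p) * powr_tail q p u * (fst x - u) / p + \<bar>u\<bar> powr q"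
    using C1 assms by (simp add: cand_b_def u_def powr_tail_def[OF assms p(1)] powr_kernel_def[OF assms p(1)])
  also have "\<dots> = \<bar>u\<bar> powr q + \<alpha> * (q * exp (u / p) * powr_tail q p u)"
    using p by (simp add: \<alpha>_def)
  finally show ?thesis
    using extremal.bellman_b_le[OF e(3) H] e by (simp add: logprim_0 logprim_1)
qed

lemma bellman_B2_cand: "ereal (cand_B2 C x) \<le> bellman_B2 C Q x"
proof -
  define u where "u = u_minus C x"
  define \<alpha> where "\<alpha> = (fst x - u) / m"
  note e = extremal_minus[OF x Q, folded u_def, folded \<alpha>_def]
  note H = primitive_on_logplus[OF e(1,2) square_conditions[of u m]]
  have ap: "\<alpha> * m = fst x - u" using m by (simp add: \<alpha>_def)
  have "cand_B2 C x = u\<^sup>2 + 2 * (fst x - u) * (u + m)"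
    using C1 by (simp add: cand_B2_def u_def power2_eq_square algebra_simps)
  also have "\<dots> = u\<^sup>2 + \<alpha> * (2 * m * u + 2 * m\<^sup>2)"
    unfolding ap[symmetric] by (simp add: power2_eq_square algebra_simps)
  finally show ?thesis
    using extremal.bellman_B2_ge[OF e(3) H] e by (simp add: logprim_0 logprim_1)
qed

lemma bellman_A_cand:
  assumes "\<delta> * p < 1" shows "ereal (cand_A \<delta> C x) \<le> bellman_A \<delta> C Q x"
proof -
  define u where "u = u_plus C x"
  define \<alpha> where "\<alpha> = (fst x - u) / p"
  note e = extremal_plus[OF x Q, folded u_def, folded \<alpha>_def]
  note H = primitive_on_logplus[OF e(1,2) logG_conditions[OF assms, of "\<delta> * u"]]
  have H': "primitive_on 0 1 (logG (\<delta> * u) (\<delta> * p) \<alpha>) (\<lambda>t. exp (\<delta> * (u + p * logplus \<alpha> t)))"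
    using H by (simp add: algebra_simps)
  have ap: "fst x - u = \<alpha> * p" using p by (simp add: \<alpha>_def)
  have "cand_A \<delta> C x = exp (\<delta> * u) * (\<alpha> * (\<delta> * p / (1 - \<delta> * p)) + 1)"
    using C1 by (simp add: cand_A_def u_def[symmetric] ap)
  also have "\<delta> * p / (1 - \<delta> * p) = 1 / (1 - \<delta> * p) - 1" using assms by (simp add: field_simps)
  finally have "cand_A \<delta> C x = exp (\<delta> * u) + \<alpha> * (exp (\<delta> * u) / (1 - \<delta> * p) - exp (\<delta> * u))"
    by (simp add: algebra_simps)
  then show ?thesis
    using extremal.bellman_A_ge[OF e(3) H'] e by (simp add: logprim_0 logprim_1)
qed

text \<open>Deals with the last branch of \<open>cand_D\<close>, in place of a proof that the four
  regions cover \<open>Omega C\<close>.\<close>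

lemma bellman_D_nonneg: "0 \<le> bellman_D l C Q x"
proof -
  define u where "u = u_plus C x"
  define \<alpha> where "\<alpha> = (fst x - u) / p"
  note e = extremal_plus[OF x Q, folded u_def, folded \<alpha>_def]
  show ?thesis using extremal.bellman_D_ge[OF e(3), of 0 l] e by (simp add: zero_ereal_def)
qed

text \<open>In this region \<open>u \<ge> l\<close>, so the whole logarithm stays at or above
  \<open>l\<close>.\<close>

lemma bellman_D_4:
  assumes "x \<in> Omega_D4 l C" shows "1 \<le> bellman_D l C Q x"
proof -
  define u where "u = u_plus C x"
  define \<alpha> where "\<alpha> = (fst x - u) / p"
  note e = extremal_plus[OF x Q, folded u_def, folded \<alpha>_def]
  have "l \<le> u"
  proof (cases "l + p \<le> fst x")
    case True
    then show ?thesis using u_plus_props[OF x] by (simp add: u_def)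
  next
    case False
    then have "snd x \<le> height p (fst x) l"
      using assms by (auto simp: Omega_D4_def height_def C_exp_p)
    then show ?thesis using le_u_plus[OF x] False by (simp add: u_def)
  qed
  then have "l \<le> u + p * logplus \<alpha> t" if "0 < t" for t
    using mult_nonneg_nonneg[OF less_imp_le[OF p(1)] logplus_nonneg[OF that, of \<alpha>]] by linarith
  then show ?thesis using extremal.bellman_D_ge[OF e(3), of 1 l] e by (simp add: one_ereal_def)
qed

text \<open>In this region \<open>u \<ge> 0\<close>, so the extremal has one sign and its modulus
  has mean \<open>fst x\<close>.\<close>

lemma bellman_b1_pos:
  assumes "x \<in> Omega_pos C" shows "bellman_b 1 C Q x \<le> ereal (fst x)"
proof -
  define u where "u = u_plus C x"
  define \<alpha> where "\<alpha> = (fst x - u) / p"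
  note e = extremal_plus[OF x Q, folded u_def, folded \<alpha>_def]
  have "0 \<le> u"
  proof (cases "p \<le> fst x")
    case True
    then show ?thesis using u_plus_props[OF x] by (simp add: u_def)
  next
    case False
    then have "snd x \<le> height p (fst x) 0"
      using assms by (auto simp: Omega_pos_def height_def C_exp_p)
    then show ?thesis using le_u_plus[OF x] False by (simp add: u_def)
  qed
  then have "0 \<le> u + p * logplus \<alpha> t" if "0 < t" for t
    using mult_nonneg_nonneg[OF less_imp_le[OF p(1)] logplus_nonneg[OF that, of \<alpha>]] by linarith
  then have "primitive_on 0 1 (logF u p \<alpha>) (\<lambda>t. \<bar>u + p * logplus \<alpha> t\<bar> powr 1)"
    by (intro primitive_on_cong[OF extremal.F[OF e(3)]]) simp
  from extremal.bellman_b_le[OF e(3) this] show ?thesis using e(4) by (metis fst_conv)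
qed

lemma bellman_b1_neg:
  assumes "x \<in> Omega_neg C" shows "bellman_b 1 C Q x \<le> ereal (- fst x)"
proof -
  define u where "u = u_minus C x"
  define \<alpha> where "\<alpha> = (fst x - u) / m"
  note e = extremal_minus[OF x Q, folded u_def, folded \<alpha>_def]
  have "u \<le> 0"
  proof (cases "fst x \<le> m")
    case True
    then show ?thesis using u_minus_props[OF x] by (simp add: u_def)
  next
    case False
    then have "snd x \<le> height m (fst x) 0"
      using assms by (auto simp: Omega_neg_def height_def C_exp_m)
    then show ?thesis using u_minus_le[OF x] False by (simp add: u_def)
  qed
  then have "u + m * logplus \<alpha> t \<le> 0" if "0 < t" for t
    using mult_nonpos_nonneg[OF less_imp_le[OF m(1)] logplus_nonneg[OF that, of \<alpha>]] by linarith
  then have abs: "\<bar>u + m * logplus \<alpha> t\<bar> powr 1 = - (u + m * logplus \<alpha> t)" if "0 < t" for t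
  proof -
    have "\<bar>y\<bar> powr 1 = - y" if "y \<le> 0" for y :: real using that by simp
    then show ?thesis using that \<open>\<And>t. 0 < t \<Longrightarrow> u + m * logplus \<alpha> t \<le> 0\<close> by blast
  qed
  have "primitive_on 0 1 (\<lambda>t. - logF u m \<alpha> t) (\<lambda>t. \<bar>u + m * logplus \<alpha> t\<bar> powr 1)"
    by (rule primitive_on_cong[OF primitive_on_uminus[OF extremal.F[OF e(3)]]]) (rule abs[symmetric])
  from extremal.bellman_b_le[OF e(3) this] show ?thesis using e(4) by (metis (no_types, lifting) fst_conv minus_diff_minus)
qed

end

end

section \<open>Extremals with two logarithms\<close>

context arc
begin

text \<open>The weights of the two tangency points become the lengths of the two logarithms. The
  constant between them is 0, the kink of the modulus, so the modulus of the extremal has mean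
  \<open>\<alpha> * p - \<gamma> * m\<close>.\<close>

lemma bellman_b1_zero:
  assumes x: "x \<in> Omega C" and Q: "a < b" "{a<..<b} \<subseteq> Q" "Q \<subseteq> {a..b}" and x0: "x \<in> Omega_zero C"
  shows "bellman_b 1 C Q x \<le> ereal (2 * ((1 - m) * (1 - p) / (p - m)) * (snd x - 1)
          + (p + m - 2) / (p - m) * fst x)"
proof -
  have e: "1 - p > 0" "1 - m > 0" "p - m > 0" using p m by auto
  have X: "m \<le> fst x" "fst x \<le> p" using x0 p m by (auto simp: Omega_zero_def)
  have up: "snd x \<le> C * exp (fst x)" using x by (auto simp: Omega_def)
  have Y: "fst x / (1 - m) \<le> snd x - 1 \<and> fst x / (1 - p) \<le> snd x - 1"
  proof (cases "fst x \<le> 0")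
    case True
    then have "fst x / (1 - p) \<le> fst x / (1 - m)"
      using p m e by (intro divide_left_mono_neg) auto
    moreover have "fst x / (1 - m) \<le> snd x - 1"
      using x0 True m by (auto simp: Omega_zero_def C_exp_m C_exp_p)
    ultimately show ?thesis by simp
  next
    case False
    then have "fst x / (1 - m) \<le> fst x / (1 - p)"
      using p m e by (intro divide_left_mono) auto
    moreover have "fst x / (1 - p) \<le> snd x - 1"
      using x0 False by (auto simp: Omega_zero_def C_exp_p)
    ultimately show ?thesis by simp
  qed
  obtain \<alpha> \<gamma> where \<alpha>: "0 \<le> \<alpha>" and \<gamma>: "0 \<le> \<gamma>" and \<alpha>\<gamma>: "\<alpha> + \<gamma> \<le> 1"
    and x1: "fst x = \<alpha> * p + \<gamma> * m" and x2: "snd x - 1 = \<alpha> * (p / (1 - p)) + \<gamma> * (m / (1 - m))"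
    using triangle_weights[OF X, of "snd x - 1"] Y up by auto
  have \<alpha>1: "\<alpha> \<le> 1" and \<gamma>1: "\<gamma> \<le> 1" using \<alpha> \<gamma> \<alpha>\<gamma> by auto
  define f where "f t = p * logplus \<alpha> t" for t
  define g where "g t = m * logplus \<gamma> (1 - t)" for t
  define F where "F t = logF 0 p \<alpha> t + - logF 0 m \<gamma> (1 - t)" for t
  \<comment> \<open>One of \<open>f t\<close>, \<open>g t\<close> is always 0, so
    \<open>exp (f t + g t) = exp (f t) + exp (g t) - 1\<close>; the summand \<open>- t\<close>
    accounts for the \<open>- 1\<close>.\<close>
  define G where "G t = logG 0 p \<alpha> t + (- logG 0 m \<gamma> (1 - t) + - t)" for t
  note EP = P_extremal_log[OF Q \<alpha> \<alpha>1, of 0]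
  note EM = M_extremal_log[OF Q \<gamma> \<gamma>1, of 0]
  have fF: "primitive_on 0 1 (logF 0 p \<alpha>) f"
    using extremal.F[OF EP] by (simp add: f_def[abs_def])
  have fG: "primitive_on 0 1 (logG 0 p \<alpha>) (\<lambda>t. exp (f t))"
    using extremal.G[OF EP] by (simp add: f_def)
  have gF: "primitive_on 0 1 (\<lambda>t. - logF 0 m \<gamma> (1 - t)) g"
    using primitive_on_reflect[OF extremal.F[OF EM], of 0] by (simp add: g_def[abs_def])
  have gG: "primitive_on 0 1 (\<lambda>t. - logG 0 m \<gamma> (1 - t)) (\<lambda>t. exp (g t))"
    using primitive_on_reflect[OF extremal.G[OF EM], of 0] by (simp add: g_def)
  have one: "primitive_on 0 1 (\<lambda>t. - t) (\<lambda>t. - 1 :: real)"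
    using primitive_on_const[of 0 1 "- 1" 0] by simp
  have disj: "f t = 0 \<or> g t = 0" for t
  proof (cases "t \<le> 1 - \<gamma>")
    case True
    then show ?thesis by (cases "t = 1 - \<gamma>") (auto simp: g_def logplus_def)
  qed (use \<alpha>\<gamma> in \<open>simp add: f_def logplus_def\<close>)
  have left: "- logF 0 m \<gamma> (1 - t) = - (\<gamma> * m)" "- logG 0 m \<gamma> (1 - t) + - t = - 1 - \<gamma> * (1 / (1 - m) - 1)"
    if "t \<le> 1 - \<gamma>" for t
    using that by (simp_all add: logprim_ge)
  have right: "logF 0 p \<alpha> t = \<alpha> * p" "logG 0 p \<alpha> t = t + \<alpha> * (1 / (1 - p) - 1)" if "\<alpha> \<le> t" for t
    using that by (simp_all add: logprim_ge)
  have F01: "F 1 - F 0 = fst x"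
    using \<alpha> \<alpha>1 \<gamma> \<gamma>1 by (simp add: F_def x1 logprim_0 logprim_1)
  have p1: "1 / (1 - p) - 1 = p / (1 - p)" and m1: "1 / (1 - m) - 1 = m / (1 - m)"
    using e by (simp_all add: field_simps)
  have G01: "G 1 - G 0 = snd x"
  proof -
    have "G 1 - G 0 = 1 + \<alpha> * (1 / (1 - p) - 1) + \<gamma> * (1 / (1 - m) - 1)"
      using \<alpha> \<alpha>1 \<gamma> \<gamma>1 by (simp add: G_def logprim_0 logprim_1)
    then show ?thesis unfolding p1 m1 using x2 by simp
  qed
  have C0: "0 < C" using C1 by simp
  have ext: "extremal C Q a b (\<lambda>t. f t + g t) F G"
  proof
    show "primitive_on 0 1 F (\<lambda>t. f t + g t)"
      unfolding F_def[abs_def] by (rule primitive_on_add[OF fF gF])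
    have "primitive_on 0 1 G (\<lambda>t. exp (f t) + (exp (g t) + - 1))"
      unfolding G_def[abs_def] by (rule primitive_on_add[OF fG primitive_on_add[OF gG one]])
    then show "primitive_on 0 1 G (\<lambda>t. exp (f t + g t))"
      by (rule primitive_on_cong) (metis disj add_0 add.right_neutral add.left_commute add.right_inverse exp_zero)
    fix s t :: real assume st: "0 \<le> s" "s < t" "t \<le> 1"
    consider "t \<le> 1 - \<gamma>" | "\<alpha> \<le> s" | "s < \<alpha>" "1 - \<gamma> < t" by linarith
    then show "below_arc C F G s t"
    proof cases
      case 1
      then show ?thesis
        using P_below_arc_log[OF st(1,2), of \<alpha> 0] left[of s] left[of t] st
        by (elim below_arc_cong) (simp_all only: F_def G_def)
    next
      case 2
      have "below_arc C (logF 0 m \<gamma>) (logG 0 m \<gamma>) (1 - t) (1 - s)"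
        by (rule M_below_arc_log) (use st in auto)
      then show ?thesis
        using right[of s] right[of t] 2 st by (simp add: below_arc_def F_def G_def)
    next
      case 3
      \<comment> \<open>The whole interval yields \<open>x\<close> itself. From it
        \<open>[0, s]\<close> and then \<open>[t, 1]\<close> are cut off, both with averages on the
        arc.\<close>
      have "below_arc C F G 0 1"
        using F01 G01 up by (simp add: below_arc_def)
      then have s1: "below_arc C F G s 1"
      proof (cases "s = 0")
        case False
        show ?thesis
        proof (rule below_arc_remove_left[OF C0 _ _ \<open>below_arc C F G 0 1\<close>])
          show "C * (s - 0) * exp ((F s - F 0) / (s - 0)) \<le> G s - G 0"
            using P_log_on_arc[of s \<alpha> 0] 3 False st \<alpha> left[of s] left[of 0] \<alpha>\<gamma> \<gamma>1
            by (simp add: F_def G_def logprim_0)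
        qed (use st False in auto)
      qed simp
      show ?thesis
      proof (cases "t = 1")
        case False
        show ?thesis
        proof (rule below_arc_remove_right[OF C0 st(2) _ s1])
          show "C * (1 - t) * exp ((F 1 - F t) / (1 - t)) \<le> G 1 - G t"
            using M_log_on_arc[of "1 - t" \<gamma> 0] 3 False st \<gamma> right[of 1] right[of t] \<alpha>\<gamma> \<alpha>1
            by (simp add: F_def G_def logprim_0)
        qed (use st False in auto)
      qed (use s1 in simp)
    qed
  qed (use Q in auto)
  have H: "primitive_on 0 1 (\<lambda>t. logF 0 p \<alpha> t + - (- logF 0 m \<gamma> (1 - t))) (\<lambda>t. \<bar>f t + g t\<bar> powr 1)"
  proof (rule primitive_on_cong[OF primitive_on_add[OF fF primitive_on_uminus[OF gF]]])
    fix t :: real assume t: "0 < t" "t < 1"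
    have "0 \<le> f t" unfolding f_def using p logplus_nonneg[of t \<alpha>] t by simp
    moreover have "g t \<le> 0" unfolding g_def using m logplus_nonneg[of "1 - t" \<gamma>] t
      by (intro mult_nonpos_nonneg) auto
    ultimately show "f t + - g t = \<bar>f t + g t\<bar> powr 1" using disj[of t] by auto
  qed
  have "2 * ((1 - m) * (1 - p) / (p - m)) * (snd x - 1) + (p + m - 2) / (p - m) * fst x = \<alpha> * p - \<gamma> * m"
  proof -
    have "2 * ((1 - m) * (1 - p) / (p - m)) * (snd x - 1)
        = 2 * (\<alpha> * p * (1 - m) + \<gamma> * m * (1 - p)) / (p - m)"
    proof -
      have "2 * (j * k / d) * (\<alpha> * (p / k) + \<gamma> * (m / j)) = 2 * (\<alpha> * p * j + \<gamma> * m * k) / d"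
        if "j > 0" "k > 0" "d > 0" for j k d :: real
        using that by (simp add: field_simps)
      from this[OF e(2,1,3)] show ?thesis unfolding x2 .
    qed
    moreover have "2 * (\<alpha> * p * (1 - m) + \<gamma> * m * (1 - p)) + (p + m - 2) * fst x = (\<alpha> * p - \<gamma> * m) * (p - m)"
      unfolding x1 by (simp add: algebra_simps)
    moreover have "p - m \<noteq> 0" using p m by simp
    ultimately show ?thesis by (simp add: field_simps flip: add_divide_distrib)
  qed
  moreover have "bellman_b 1 C Q x \<le> ereal (\<alpha> * p - \<gamma> * m)"
    using extremal.bellman_b_le[OF ext H] F01 G01 \<alpha> \<alpha>1 \<gamma> \<gamma>1 by (simp add: logprim_0 logprim_1)
  ultimately show ?thesis by simp
qed

text \<open>Rules out the default value 0 of \<open>cand_b1\<close>, which need not be an upper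
  bound.\<close>

lemma Omega_cover_b1:
  assumes "x \<in> Omega C" "x \<notin> Omega_neg C" "x \<notin> Omega_pos C"
  shows "x \<in> Omega_zero C"
  using assms p m unfolding Omega_def Omega_neg_def Omega_pos_def Omega_zero_def by force

lemma bellman_b1:
  assumes x: "x \<in> Omega C" and Q: "a < b" "{a<..<b} \<subseteq> Q" "Q \<subseteq> {a..b}"
  shows "bellman_b 1 C Q x \<le> ereal (cand_b 1 C x)"
  using bellman_b1_neg[OF x Q] bellman_b1_pos[OF x Q] bellman_b1_zero[OF x Q] Omega_cover_b1[OF x] C1
  by (auto simp: cand_b_def cand_b1_def)

end

section \<open>Extremals for the level set problem\<close>

text \<open>Equivalent to \<open>(1 - z) * exp z < 1\<close> for
  \<open>z = w - y \<noteq> 0\<close>.\<close>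

lemma exp_gt_tangent:
  assumes "y \<noteq> w" shows "exp w * (1 + (y - w)) < exp (y::real)"
proof -
  have "(1 - (w - y)) * exp (w - y) < (1 - 0) * exp (0::real)"
    using one_minus_mult_exp_mono[of "w - y" 0] one_minus_mult_exp_anti[of 0 "w - y"] assms
    by (cases "y < w") auto
  then have "(1 - (w - y)) * exp (w - y) * exp y < (1 - 0) * exp 0 * exp y"
    by (intro mult_strict_right_mono) simp_all
  moreover have "(1 - (w - y)) * exp (w - y) * exp y = exp w * (1 + (y - w))"
    by (simp add: mult.assoc flip: exp_add)
  ultimately show ?thesis by simp
qed

text \<open>Strictness makes the second intersection \<open>v_pt\<close> of a line with the lower
  boundary unique.\<close>

lemma exp_slope_less:
  fixes v w l :: real
  assumes "v < w" "w < l"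
  shows "(exp v - exp l) / (v - l) < (exp w - exp l) / (w - l)"
proof -
  have 1: "exp w * (v - w) < exp v - exp w" and 2: "exp w * (l - w) < exp l - exp w"
    using exp_gt_tangent[of v w] exp_gt_tangent[of l w] assms by (auto simp: algebra_simps)
  have "(exp l - exp w) * (v - w) < exp w * (l - w) * (v - w)"
    using 2 assms by (intro mult_strict_right_mono_neg) auto
  also have "\<dots> = (l - w) * (exp w * (v - w))" by simp
  also have "\<dots> < (l - w) * (exp v - exp w)" using 1 assms by (intro mult_strict_left_mono) auto
  finally have "(exp l - exp v) * (l - w) < (exp l - exp w) * (l - v)" by (simp add: algebra_simps)
  then have "(exp l - exp v) / (l - v) < (exp l - exp w) / (l - w)"
    using assms by (simp add: divide_simps)
  moreover have "(exp y - exp l) / (y - l) = (exp l - exp y) / (l - y)" if "y < l" for y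
    using nonzero_minus_divide_divide[of "y - l" "exp y - exp l"] that by simp
  ultimately show ?thesis using assms by simp
qed

context arc
begin

text \<open>The tangent from \<open>(l, exp l)\<close> that touches the arc at \<open>l + m\<close> meets the lower boundary again
  at \<open>foot l\<close>.\<close>

abbreviation "foot l \<equiv> l - (p - m)"

lemma exp_foot: "exp (foot l) = exp l * (1 - (p - m) / (1 - m))"
proof -
  have "exp (foot l) = exp l / exp (p - m)" by (simp add: exp_diff)
  also have "\<dots> = exp l * ((1 - p) / (1 - m))"
    unfolding exp_p_minus_m using p m by (simp add: field_simps)
  also have "(1 - p) / (1 - m) = 1 - (p - m) / (1 - m)" using m by (simp add: field_simps)
  finally show ?thesis .
qed

text \<open>Two descriptions of the tangent touching over \<open>l + m\<close>: with root
  \<open>p\<close> from the foot point, with root \<open>m\<close> from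
  \<open>(l, exp l)\<close>.\<close>

lemma height_foot: "height p y (foot l) = exp l * (1 + (y - l) / (1 - m))"
proof -
  have "exp (foot l) = exp l / exp (p - m)" by (simp add: exp_diff)
  also have "\<dots> = exp l * ((1 - p) / (1 - m))"
    unfolding exp_p_minus_m using p m by (simp add: field_simps)
  finally have "height p y (foot l) = exp l / (1 - m) * ((1 - p) * ((y - foot l) / (1 - p) + 1))"
    by (simp add: height_def)
  also have "(1 - p) * ((y - foot l) / (1 - p) + 1) = (1 - m) + (y - l)" using p by (simp add: field_simps)
  also have "exp l / (1 - m) * ((1 - m) + (y - l)) = exp l * (1 + (y - l) / (1 - m))"
    using m by (simp add: field_simps)
  finally show ?thesis .
qed

context
  fixes x :: "real \<times> real" and Q :: "real set" and a b l :: real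
  assumes x: "x \<in> Omega C" and Q: "a < b" "{a<..<b} \<subseteq> Q" "Q \<subseteq> {a..b}"
begin

text \<open>\<open>x\<close> is on a chord from \<open>(l, exp l)\<close> that is at least as steep
  as the tangent to the foot point. Hence \<open>foot l \<le> v\<close>, and the two-valued function
  is covered by \<open>below_arc_step\<close>.\<close>

lemma bellman_D_2:
  assumes "x \<in> Omega_D2 l C"
  shows "ereal ((fst x - v_pt l x) / (l - v_pt l x)) \<le> bellman_D l C Q x"
proof -
  let ?\<sigma> = "\<lambda>v. (exp v - exp l) / (v - l)" and ?k = "(snd x - exp l) / (fst x - l)"
  have x1: "foot l \<le> fst x" "fst x < l" and x2: "exp (fst x) \<le> snd x" "snd x \<le> exp l * (1 + (fst x - l) / (1 - m))"
    using assms by (auto simp: Omega_D2_def C_exp_m algebra_simps)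
  have d: "p - m > 0" using p m by simp
  have "?\<sigma> (foot l) = exp l / (1 - m)"
  proof -
    have "E * (1 - d / e) - E = - d * (E / e)" for E d e :: real by (simp add: algebra_simps)
    then have "exp (foot l) - exp l = - (p - m) * (exp l / (1 - m))" unfolding exp_foot .
    moreover have "foot l - l = - (p - m)" by simp
    ultimately show ?thesis using d by (simp only:) simp
  qed
  also have "\<dots> \<le> ?k"
    using x2(2) x1 m by (simp add: field_simps)
  finally have lo: "?\<sigma> (foot l) \<le> ?k" .
  have hi: "?k \<le> ?\<sigma> (fst x)" using x2(1) x1 by (intro divide_right_mono_neg) auto
  have "\<exists>v\<ge>foot l. v \<le> fst x \<and> ?\<sigma> v = ?k"
    by (rule IVT'[OF lo hi x1(1)]) (use x1 in \<open>auto intro!: continuous_intros\<close>)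
  then obtain v where v: "foot l \<le> v" "v \<le> fst x" "?\<sigma> v = ?k" by blast
  have vl: "v < l" using v x1 by simp
  have vpt: "v_pt l x = v"
    unfolding v_pt_def
  proof (rule the_equality)
    fix w assume w: "w < l \<and> ?\<sigma> w = ?k"
    then show "w = v"
      using exp_slope_less[of v w l] exp_slope_less[of w v l] v vl
      by (cases v w rule: linorder_cases) auto
  qed (use v vl in simp)
  define \<beta> where "\<beta> = (fst x - v) / (l - v)"
  have \<beta>: "0 \<le> \<beta>" "\<beta> \<le> 1" unfolding \<beta>_def using v vl x1 by (auto simp: divide_simps)
  have ext: "extremal C Q a b (\<lambda>t. if t \<le> \<beta> then l else v) (step_prim l v \<beta>) (step_prim (exp l) (exp v) \<beta>)"
  proof
    show "primitive_on 0 1 (step_prim l v \<beta>) (\<lambda>t. if t \<le> \<beta> then l else v)"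
      by (rule primitive_on_step[OF \<beta>])
    show "primitive_on 0 1 (step_prim (exp l) (exp v) \<beta>) (\<lambda>t. exp (if t \<le> \<beta> then l else v))"
      using primitive_on_step[OF \<beta>, of "exp l" "exp v"] by (simp add: if_distrib)
    show "below_arc C (step_prim l v \<beta>) (step_prim (exp l) (exp v) \<beta>) s t" if "s < t" for s t
      by (rule below_arc_step[OF that v(1)]) (use vl in simp)
  qed (use Q in auto)
  have \<beta>': "1 - \<beta> = (l - fst x) / (l - v)" unfolding \<beta>_def using vl by (simp add: field_simps)
  have "step_prim l v \<beta> 1 - step_prim l v \<beta> 0 = l + (v - l) * (1 - \<beta>)"
    using \<beta> by (simp add: step_prim_def)
  also have "\<dots> = fst x" unfolding \<beta>' using vl by (simp add: field_simps)
  finally have 1: "step_prim l v \<beta> 1 - step_prim l v \<beta> 0 = fst x" .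
  have "step_prim (exp l) (exp v) \<beta> 1 - step_prim (exp l) (exp v) \<beta> 0 = exp l + (exp v - exp l) * (1 - \<beta>)"
    using \<beta> by (simp add: step_prim_def)
  also have "\<dots> = exp l + ?\<sigma> v * (fst x - l)" unfolding \<beta>' using vl by (simp add: field_simps)
  also have "\<dots> = snd x" unfolding v(3) using x1 by simp
  finally have 2: "step_prim (exp l) (exp v) \<beta> 1 - step_prim (exp l) (exp v) \<beta> 0 = snd x" .
  show ?thesis using extremal.bellman_D_ge[OF ext \<beta>, of l] 1 2 by (simp add: vpt \<beta>_def)
qed

text \<open>The points of the ray from the foot point through \<open>x\<close> beyond \<open>x\<close>: the ray leaves the
  region above the arc before it reaches \<open>x\<close> and does not return, by convexity.\<close>

lemma ray_below_arc:
  assumes \<nu>: "\<nu> + p < fst x" and t: "0 < t" "t < 1"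
    and z: "fst x = t * z1 + (1 - t) * \<nu>" "snd x = t * z2 + (1 - t) * exp \<nu>"
    and above: "height p z1 \<nu> \<le> z2"
  shows "z2 \<le> C * exp z1"
proof -
  \<comment> \<open>At parameter \<open>r\<close> the ray passes over the tangency abscissa
    \<open>\<nu> + p\<close>, where being above the tangent means being on or above the arc.\<close>
  define r where "r = p / (z1 - \<nu>)"
  have tz: "t * (z1 - \<nu>) = fst x - \<nu>" using z by (simp add: algebra_simps)
  then have "0 < t * (z1 - \<nu>)" using \<nu> p by simp
  then have z\<nu>: "0 < z1 - \<nu>" using t by (simp add: zero_less_mult_iff)
  have r0: "0 < r" using p z\<nu> by (simp add: r_def)
  have "p < t * (z1 - \<nu>)" using tz \<nu> by simp
  then have rt: "r < t" using z\<nu> by (simp add: r_def divide_simps)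
  \<comment> \<open>\<open>w\<close> and \<open>q\<close> are the weights of \<open>x\<close>
    between that point of the ray and \<open>(z1, z2)\<close>.\<close>
  define w where "w = (1 - t) / (1 - r)"
  define q where "q = (t - r) / (1 - r)"
  have r1: "1 - r > 0" using rt t by simp
  have wq: "0 < w" "0 < q" "w + q = 1" "w * (1 - r) = 1 - t"
    using rt t r1 by (auto simp: w_def q_def field_simps)
  have "w * r + q = (w + q) - w * (1 - r)" by (simp add: algebra_simps)
  then have wrq: "w * r + q = t" unfolding wq(3,4) by simp
  let ?h1 = "\<nu> + p" and ?h2 = "(1 - r) * exp \<nu> + r * z2"
  have rz: "r * (z1 - \<nu>) = p" using z\<nu> by (simp add: r_def)
  have "C * exp ?h1 = height p ?h1 \<nu>"
    using P_height_ends(2)[of ?h1] by simp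
  also have "\<dots> = exp \<nu> * (r * (z1 - \<nu>) / (1 - p) + 1)" unfolding rz by (simp add: height_def)
  also have "\<dots> = (1 - r) * exp \<nu> + r * height p z1 \<nu>" by (simp add: height_def algebra_simps)
  also have "\<dots> \<le> ?h2" using above r0 by (intro add_mono order_refl mult_left_mono) auto
  finally have h: "C * exp ?h1 \<le> ?h2" .
  have s1: "w * ?h1 + q * z1 = fst x"
  proof -
    have "w * ?h1 + q * z1 = w * (\<nu> + r * (z1 - \<nu>)) + q * z1" by (simp add: rz)
    also have "\<dots> = w * (1 - r) * \<nu> + (w * r + q) * z1" by (simp add: algebra_simps)
    finally show ?thesis unfolding wq(4) wrq z(1) by simp
  qed
  have s2: "w * ?h2 + q * z2 = snd x"
  proof -
    have "w * ?h2 + q * z2 = w * (1 - r) * exp \<nu> + (w * r + q) * z2" by (simp add: algebra_simps)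
    then show ?thesis unfolding wq(4) wrq z(2) by simp
  qed
  have "q * z2 \<le> C * q * exp (q * z1 / q)"
  proof (rule remove_above_arc[OF wq(1,2)])
    show "C * w * exp (w * ?h1 / w) \<le> w * ?h2"
      using mult_left_mono[OF h, of w] wq by (simp add: mult_ac)
    show "w * ?h2 + q * z2 \<le> C * (w + q) * exp ((w * ?h1 + q * z1) / (w + q))"
      unfolding s1 s2 wq(3) using x by (auto simp: Omega_def)
  qed (use C1 in simp)
  then have "q * z2 \<le> q * (C * exp z1)" using wq by (simp add: mult_ac)
  then show ?thesis using wq by simp
qed

text \<open>The triangle vertex over \<open>l + m\<close> lies on the chord from
  \<open>(l, exp l)\<close> to the foot point. It is realised by these two values rather than by a
  logarithm below \<open>l\<close>, so only the share \<open>1 - \<beta>\<close> falls below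
  \<open>l\<close>.\<close>

lemma bellman_D_3:
  assumes "x \<in> Omega_D3 l C"
  shows "ereal ((1 - m) / (p - m)\<^sup>2 * (fst x - l + (1 - snd x * exp (- l)) * (1 - p)) + 1) \<le> bellman_D l C Q x"
proof -
  let ?X = "fst x - l" and ?Y = "snd x * exp (- l) - 1" and ?\<mu> = "foot l"
  have e: "1 - p > 0" "1 - m > 0" "p - m > 0" using p m by auto
  have X: "m \<le> ?X" "?X \<le> p" using assms p m by (auto simp: Omega_D3_def)
  have up: "snd x \<le> C * exp (fst x)" using x by (auto simp: Omega_def)
  have up': "1 + ?Y \<le> C * exp ?X"
    using mult_right_mono[OF up, of "exp (- l)"] by (simp add: exp_diff exp_minus divide_inverse)
  have low: "y \<le> ?Y" if "exp l * (y + 1) \<le> snd x" for y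
    using that by (simp add: exp_minus field_simps)
  have Y: "?X / (1 - m) \<le> ?Y \<and> ?X / (1 - p) \<le> ?Y"
  proof (cases "?X \<le> 0")
    case True
    then have "?X / (1 - p) \<le> ?X / (1 - m)"
      using p m e by (intro divide_left_mono_neg) auto
    moreover have "?X / (1 - m) \<le> ?Y"
      by (rule low) (use assms True m in \<open>auto simp: Omega_D3_def C_exp_m C_exp_p\<close>)
    ultimately show ?thesis by simp
  next
    case False
    then have "?X / (1 - m) \<le> ?X / (1 - p)"
      using p m e by (intro divide_left_mono) auto
    moreover have "?X / (1 - p) \<le> ?Y"
      by (rule low) (use assms False in \<open>auto simp: Omega_D3_def C_exp_p\<close>)
    ultimately show ?thesis by simp
  qed
  obtain \<alpha> \<gamma> where \<alpha>: "0 \<le> \<alpha>" and \<gamma>: "0 \<le> \<gamma>" and \<alpha>\<gamma>: "\<alpha> + \<gamma> \<le> 1"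
    and x1: "?X = \<alpha> * p + \<gamma> * m" and x2: "?Y = \<alpha> * (p / (1 - p)) + \<gamma> * (m / (1 - m))"
    using triangle_weights[OF X, of ?Y] Y up' by auto
  \<comment> \<open>\<open>(- m) / (p - m)\<close> is the share of the foot point in the tangency
    point over \<open>l + m\<close>.\<close>
  define \<beta> where "\<beta> = 1 - \<gamma> * (- m) / (p - m)"
  have \<beta>d: "(1 - \<beta>) * (p - m) = \<gamma> * (- m)" using e by (simp add: \<beta>_def)
  have "\<gamma> * (- m) / (p - m) \<le> \<gamma>" using mult_nonneg_nonneg[OF \<gamma> less_imp_le[OF p(1)]] e by (simp add: divide_simps algebra_simps)
  then have \<alpha>\<beta>: "\<alpha> \<le> \<beta>" using \<alpha>\<gamma> by (simp add: \<beta>_def)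
  have "0 \<le> \<gamma> * (- m) / (p - m)" using \<gamma> m e by (intro divide_nonneg_pos mult_nonneg_nonneg) auto
  then have \<beta>1: "\<beta> \<le> 1" unfolding \<beta>_def by linarith
  have \<beta>0: "0 \<le> \<beta>" and \<alpha>1: "\<alpha> \<le> 1" using \<alpha> \<alpha>\<beta> \<beta>1 by auto
  txt \<open>A logarithmic start above \<open>l\<close>, then \<open>l\<close>, then the foot point on \<open>(\<beta>, 1)\<close>.\<close>
  define F where "F t = logF l p \<alpha> t + step_prim 0 (?\<mu> - l) \<beta> t" for t
  define G where "G t = logG l p \<alpha> t + step_prim 0 (exp ?\<mu> - exp l) \<beta> t" for t
  define f where "f t = l + p * logplus \<alpha> t" for t
  define \<phi> where "\<phi> t = f t + (if t \<le> \<beta> then 0 else ?\<mu> - l)" for t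
  note EP = P_extremal_log[OF Q \<alpha> \<alpha>1, of l, folded f_def]
  have left: "F t = logF l p \<alpha> t" "G t = logG l p \<alpha> t" if "t \<le> \<beta>" for t
    using that by (simp_all add: F_def G_def step_prim_def)
  have right: "F t = step_prim l ?\<mu> \<beta> t + \<alpha> * p"
      "G t = step_prim (exp l) (exp ?\<mu>) \<beta> t + \<alpha> * (exp l / (1 - p) - exp l)" if "\<alpha> \<le> t" for t
    using that by (simp_all add: F_def G_def logprim_ge step_prim_def)
  have F0: "F 0 = 0" and G0: "G 0 = 0" using left[of 0] \<beta>0 \<alpha> by (simp_all add: logprim_0)
  have F1: "F 1 = fst x"
  proof -
    have "F 1 = l - (1 - \<beta>) * (p - m) + \<alpha> * p"
      using right[of 1] \<alpha>1 \<beta>1 by (simp add: step_prim_def algebra_simps)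
    then show ?thesis unfolding \<beta>d using x1 by simp
  qed
  have G1: "G 1 = snd x"
  proof -
    have "exp ?\<mu> - exp l = - (exp l * ((p - m) / (1 - m)))"
      unfolding exp_foot by (simp only: right_diff_distrib)
    then have "(exp ?\<mu> - exp l) * (1 - \<beta>) = - exp l * ((1 - \<beta>) * (p - m)) / (1 - m)"
      by (simp add: mult_ac)
    then have "(exp ?\<mu> - exp l) * (1 - \<beta>) = exp l * (\<gamma> * (m / (1 - m)))" unfolding \<beta>d by simp
    moreover have "exp l / (1 - p) - exp l = exp l * (p / (1 - p))"
      using e by (simp add: field_simps)
    ultimately have "G 1 = exp l * (1 + (\<alpha> * (p / (1 - p)) + \<gamma> * (m / (1 - m))))"
      using right[of 1] \<alpha>1 \<beta>1 by (simp add: step_prim_def algebra_simps)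
    also have "\<dots> = snd x" unfolding x2[symmetric] by (simp add: exp_minus)
    finally show ?thesis .
  qed
  have C0: "0 < C" using C1 by simp
  \<comment> \<open>The average over \<open>[0, t]\<close> is either below the tangent through the
    foot point, or above it with \<open>x\<close> between it and the foot point, so that
    \<open>ray_below_arc\<close> applies.\<close>
  have from0: "below_arc C F G 0 t" if t: "\<beta> < t" "t \<le> 1" for t
  proof (cases "gap p ?\<mu> F G t \<le> 0")
    case True
    then show ?thesis
      using P_below_arcI[of 0 t ?\<mu> F G] t \<beta>0 F0 G0 by (simp add: gap_def)
  next
    case False
    have t0: "0 < t" using t \<beta>0 by simp
    have F1t: "F 1 = F t + (1 - t) * ?\<mu>" and G1t: "G 1 = G t + (1 - t) * exp ?\<mu>"
      using right[of 1] right[of t] t \<alpha>\<beta> \<alpha>1 by (simp_all add: step_prim_def algebra_simps)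
    have hg: "height p (F t / t) ?\<mu> = exp ?\<mu> * (t * (1 - ?\<mu> / (1 - p)) + F t / (1 - p)) / t"
    proof -
      have "E * ((y / t - \<nu>) / k + 1) = E * (t * (1 - \<nu> / k) + y / k) / t" if "k > 0" for E y \<nu> k
        using that t0 by (simp add: field_simps)
      from this[OF e(1)] show ?thesis unfolding height_def .
    qed
    have above: "height p (F t / t) ?\<mu> < G t / t"
      unfolding hg using False t0 by (simp add: gap_def divide_strict_right_mono)
    show ?thesis
    proof (cases "t = 1")
      case True
      then show ?thesis using F0 G0 F1 G1 up by (simp add: below_arc_def)
    next
      case False
      then have t1: "t < 1" using t by simp
      have z: "fst x = t * (F t / t) + (1 - t) * ?\<mu>" "snd x = t * (G t / t) + (1 - t) * exp ?\<mu>"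
        using F1t G1t F1 G1 t0 by simp_all
      \<comment> \<open>\<open>x\<close> is strictly above the tangent, so it cannot lie over the
        tangency abscissa \<open>?\<mu> + p = l + m\<close>; this makes the bound from
        \<open>X\<close> strict.\<close>
      have "height p (fst x) ?\<mu> = t * height p (F t / t) ?\<mu> + (1 - t) * exp ?\<mu>"
      proof -
        have "E * ((t * y + (1 - t) * \<nu> - \<nu>) / k + 1) = t * (E * ((y - \<nu>) / k + 1)) + (1 - t) * E"
          for E y \<nu> k :: real by (simp add: algebra_simps add_divide_distrib diff_divide_distrib)
        then show ?thesis unfolding z(1) height_def .
      qed
      also have "\<dots> < snd x"
        unfolding z(2) using above t0 by (intro add_strict_right_mono mult_strict_left_mono)
      finally have "height p (fst x) ?\<mu> < snd x" .
      moreover have "height p (?\<mu> + p) ?\<mu> = C * exp (?\<mu> + p)"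
        using P_height_ends(2)[of "?\<mu> + p"] by (simp only: add_diff_cancel_right')
      ultimately have "fst x \<noteq> ?\<mu> + p" using up by (metis not_le)
      then have "?\<mu> + p < fst x" using X(1) by simp
      from ray_below_arc[OF this t0 t1 z less_imp_le[OF above]]
      have "G t / t \<le> C * exp (F t / t)" .
      then show ?thesis using F0 G0 t0 by (simp add: below_arc_def divide_simps mult_ac)
    qed
  qed
  have ext: "extremal C Q a b \<phi> F G"
  proof
    show "primitive_on 0 1 F \<phi>"
      unfolding F_def[abs_def] \<phi>_def[abs_def]
      by (rule primitive_on_add[OF extremal.F[OF EP] primitive_on_step[OF \<beta>0 \<beta>1]])
    have "primitive_on 0 1 G (\<lambda>t. exp (f t) + (if t \<le> \<beta> then 0 else exp ?\<mu> - exp l))"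
      unfolding G_def[abs_def]
      by (rule primitive_on_add[OF extremal.G[OF EP] primitive_on_step[OF \<beta>0 \<beta>1]])
    \<comment> \<open>The correction can be additive since \<open>f t = l\<close> beyond
      \<open>\<beta>\<close>, as \<open>\<alpha> \<le> \<beta>\<close>.\<close>
    moreover have "exp (f t) + (if t \<le> \<beta> then 0 else exp ?\<mu> - exp l) = exp (\<phi> t)" for t
      using \<alpha>\<beta> by (simp add: \<phi>_def f_def logplus_def)
    ultimately show "primitive_on 0 1 G (\<lambda>t. exp (\<phi> t))" by simp
    fix s t :: real assume st: "0 \<le> s" "s < t" "t \<le> 1"
    consider "t \<le> \<beta>" | "\<alpha> \<le> s" | "s < \<alpha>" "\<beta> < t" by linarith
    then show "below_arc C F G s t"
    proof cases
      case 1
      then show ?thesis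
        using P_below_arc_log[OF st(1,2), of \<alpha> l] left[of s] left[of t] st by (simp add: below_arc_def)
    next
      case 2
      then show ?thesis
        using below_arc_step[OF st(2), of l ?\<mu> \<beta>] right[of s] right[of t] st e by (simp add: below_arc_def)
    next
      case 3
      show ?thesis
      proof (cases "s = 0")
        case False
        show ?thesis
        proof (rule below_arc_remove_left[OF C0 _ st(2) from0[OF 3(2) st(3)]])
          show "C * (s - 0) * exp ((F s - F 0) / (s - 0)) \<le> G s - G 0"
            using P_log_on_arc[of s \<alpha> l] 3 False st F0 G0 left[of s] \<alpha>\<beta> by simp
        qed (use st False in simp)
      qed (use from0 3 st in simp)
    qed
  qed (use Q in auto)
  have "l \<le> \<phi> t" if "0 < t" "t < \<beta>" for t
    using that mult_nonneg_nonneg[OF less_imp_le[OF p(1)] logplus_nonneg[OF that(1), of \<alpha>]]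
    by (simp add: \<phi>_def f_def)
  from extremal.bellman_D_ge[OF ext \<beta>0 \<beta>1 this] have "ereal \<beta> \<le> bellman_D l C Q x"
    by (simp add: F0 G0 F1 G1)
  moreover have "(1 - m) / (p - m)\<^sup>2 * (?X + (1 - snd x * exp (- l)) * (1 - p)) + 1 = \<beta>"
  proof -
    have "?X + (1 - snd x * exp (- l)) * (1 - p) = ?X - ?Y * (1 - p)" by (simp add: algebra_simps)
    also have "\<dots> = \<gamma> * m * (p - m) / (1 - m)"
    proof -
      have "\<alpha> * p + \<gamma> * m - (\<alpha> * (p / k) + \<gamma> * (m / j)) * k = \<gamma> * m * (j - k) / j"
        if "j > 0" "k > 0" for j k :: real
        using that by (simp add: field_simps)
      from this[OF e(2,1)] show ?thesis unfolding x1 x2 by simp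
    qed
    finally have "(1 - m) / (p - m)\<^sup>2 * (?X + (1 - snd x * exp (- l)) * (1 - p)) + 1
        = (1 - m) / ((p - m) * (p - m)) * (\<gamma> * m * (p - m) / (1 - m)) + 1"
      by (simp only: power2_eq_square)
    also have "\<dots> = \<beta>"
    proof -
      have "j / (d * d) * (\<gamma> * m * d / j) + 1 = 1 - \<gamma> * (- m) / d" if "j > 0" "d > 0" for j d :: real
        using that by (simp add: field_simps)
      from this[OF e(2,3)] show ?thesis unfolding \<beta>_def .
    qed
    finally show ?thesis .
  qed
  ultimately show ?thesis by simp
qed

lemma bellman_D_1:
  assumes "x \<in> Omega_D1 l C"
  shows "ereal (1 / (p - m) * exp ((p - m + u_plus C x - l) / p) * (fst x - u_plus C x)) \<le> bellman_D l C Q x"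
proof -
  let ?\<mu> = "foot l"
  define u where "u = u_plus C x"
  define \<alpha> where "\<alpha> = (fst x - u) / p"
  note E = extremal_plus[OF x Q, folded u_def, folded \<alpha>_def]
  have e: "1 - p > 0" "1 - m > 0" "p - m > 0" "p > 0" using p m by auto
  have u: "u \<le> ?\<mu>"
  proof (cases "fst x \<le> ?\<mu>")
    case True
    then show ?thesis using u_plus_props[OF x] by (simp add: u_def)
  next
    case False
    then have "fst x - p \<le> ?\<mu>" "height p (fst x) ?\<mu> \<le> snd x"
      unfolding height_foot using assms by (auto simp: Omega_D1_def C_exp_m algebra_simps)
    then show ?thesis using u_plus_le[OF x] by (simp add: u_def)
  qed
  txt \<open>The logarithm of \<open>extremal_plus\<close> exceeds \<open>foot l\<close> exactly on \<open>(0, \<gamma>)\<close>. There it is replaced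
    by a step function with the values \<open>l\<close> and \<open>foot l\<close> and the same averages over \<open>(0, \<gamma>)\<close>.\<close>
  define \<gamma> where "\<gamma> = \<alpha> * exp ((u - ?\<mu>) / p)"
  \<comment> \<open>The share of \<open>l\<close> for which the mean of \<open>l\<close> and
    \<open>foot l\<close> is \<open>foot l + p = l + m\<close>, the tangency abscissa; the logarithm
    over \<open>(0, \<gamma>)\<close> has the same mean.\<close>
  define \<kappa> where "\<kappa> = p / (p - m)"
  have \<kappa>: "0 \<le> \<kappa>" "\<kappa> \<le> 1" "\<kappa> * (p - m) = p" using e m by (auto simp: \<kappa>_def divide_simps)
  have "exp ((u - ?\<mu>) / p) \<le> 1" using u e by (simp add: divide_simps)
  then have \<gamma>\<alpha>: "\<gamma> \<le> \<alpha>" using E(1) mult_left_mono[of _ 1 \<alpha>] by (simp add: \<gamma>_def)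
  have \<gamma>0: "0 \<le> \<gamma>" using E(1) by (simp add: \<gamma>_def)
  have \<gamma>1: "\<gamma> \<le> 1" using \<gamma>\<alpha> E(2) by simp
  have \<kappa>\<gamma>: "0 \<le> \<kappa> * \<gamma>" "\<kappa> * \<gamma> \<le> \<gamma>" using \<kappa> \<gamma>0 by (auto simp: mult_left_le_one_le)
  have ln\<gamma>: "ln (\<alpha> / \<gamma>) = (?\<mu> - u) / p" if "0 < \<gamma>"
  proof -
    have "0 < \<alpha>" using that \<gamma>\<alpha> by simp
    then have "\<alpha> / \<gamma> = exp (- ((u - ?\<mu>) / p))"
      by (simp only: \<gamma>_def exp_minus) (simp add: divide_inverse)
    moreover have "- ((u - ?\<mu>) / p) = (?\<mu> - u) / p" by (metis minus_diff_eq minus_divide_left)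
    ultimately show ?thesis by simp
  qed
  let ?sF = "step_prim l ?\<mu> (\<kappa> * \<gamma>)" and ?sG = "step_prim (exp l) (exp ?\<mu>) (\<kappa> * \<gamma>)"
  have glueF: "?sF \<gamma> = logF u p \<alpha> \<gamma>"
  proof -
    have "?sF \<gamma> = \<gamma> * (?\<mu> + \<kappa> * (p - m))" using \<kappa>\<gamma> by (simp add: step_prim_def algebra_simps)
    also have "\<dots> = logF u p \<alpha> \<gamma>"
      using \<gamma>\<alpha> \<gamma>0 ln\<gamma> e by (cases "\<gamma> = 0") (auto simp: logprim_def \<kappa>(3))
    finally show ?thesis .
  qed
  have glueG: "?sG \<gamma> = logG u p \<alpha> \<gamma>"
  proof -
    have el: "exp l = exp ?\<mu> * (1 + (p - m) / (1 - p))"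
      unfolding exp_p_minus_m[symmetric] by (simp flip: exp_add)
    have "?sG \<gamma> = \<gamma> * (exp ?\<mu> + \<kappa> * (exp l - exp ?\<mu>))" using \<kappa>\<gamma> by (simp add: step_prim_def algebra_simps)
    also have "\<kappa> * (exp l - exp ?\<mu>) = exp ?\<mu> * (\<kappa> * (p - m)) / (1 - p)"
      unfolding el by (simp only: distrib_left mult_1_right add_diff_cancel_left') simp
    also have "\<gamma> * (exp ?\<mu> + exp ?\<mu> * (\<kappa> * (p - m)) / (1 - p)) = \<gamma> * (exp ?\<mu> / (1 - p))"
      unfolding \<kappa>(3) using e by (simp add: field_simps)
    also have "\<dots> = logG u p \<alpha> \<gamma>"
      using \<gamma>\<alpha> \<gamma>0 ln\<gamma> e by (cases "\<gamma> = 0") (auto simp: logprim_def)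
    finally show ?thesis .
  qed
  define F where "F t = (if t \<le> \<gamma> then ?sF t else logF u p \<alpha> t)" for t
  define G where "G t = (if t \<le> \<gamma> then ?sG t else logG u p \<alpha> t)" for t
  define \<phi> where "\<phi> t = (if t \<le> \<gamma> then (if t \<le> \<kappa> * \<gamma> then l else ?\<mu>) else u + p * logplus \<alpha> t)" for t
  have right: "F t = logF u p \<alpha> t" "G t = logG u p \<alpha> t" if "\<gamma> \<le> t" for t
    using that glueF glueG by (auto simp: F_def G_def antisym_conv)
  have left: "F t = ?sF t" "G t = ?sG t" if "t \<le> \<gamma>" for t
    using that by (simp_all add: F_def G_def)
  \<comment> \<open>Substitute for \<open>gap_log_nonneg\<close> on the replaced part. The gap
    starts at 0, first does not decrease, then is affine down or up to its value at
    \<open>\<gamma>\<close>, which is that of the logarithm and hence nonnegative.\<close>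
  have gap_left: "0 \<le> gap p \<nu> F G s" if \<nu>: "\<nu> \<le> ?\<mu>" and s: "0 \<le> s" "s \<le> \<gamma>" for \<nu> s
  proof -
    have gap: "gap p \<nu> F G r = (r - max 0 (r - \<kappa> * \<gamma>)) * excess \<nu> l + max 0 (r - \<kappa> * \<gamma>) * excess \<nu> ?\<mu>"
      if "r \<le> \<gamma>" for r
      using gap_step[of \<nu> l ?\<mu> "\<kappa> * \<gamma>" r] left[OF that] by (simp add: gap_def)
    have el: "0 \<le> excess \<nu> l" by (rule excess_nonneg) (use \<nu> in simp)
    consider "s \<le> \<kappa> * \<gamma>" | "0 \<le> excess \<nu> ?\<mu>" | "\<kappa> * \<gamma> < s" "excess \<nu> ?\<mu> < 0" by linarith
    then show ?thesis
    proof cases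
      case 1
      then show ?thesis unfolding gap[OF s(2)] using el s by simp
    next
      case 2
      then show ?thesis unfolding gap[OF s(2)] using el s \<kappa>\<gamma>
        by (intro add_nonneg_nonneg mult_nonneg_nonneg) auto
    next
      case 3
      have "gap p \<nu> F G \<gamma> = gap p \<nu> F G s + (\<gamma> - s) * excess \<nu> ?\<mu>"
        unfolding gap[OF s(2)] gap[OF order_refl] using 3 s by (simp add: algebra_simps)
      moreover have "0 \<le> gap p \<nu> F G \<gamma>"
        using P_gap_log_nonneg[OF \<gamma>0 \<gamma>\<alpha>, of \<nu> u] right[of \<gamma>] by (simp add: gap_def)
      moreover have "(\<gamma> - s) * excess \<nu> ?\<mu> \<le> 0" using 3 s by (intro mult_nonneg_nonpos) auto
      ultimately show ?thesis by linarith
    qed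
  qed
  have ext: "extremal C Q a b \<phi> F G"
  proof
    show "primitive_on 0 1 F \<phi>"
      unfolding F_def[abs_def] \<phi>_def[abs_def]
      by (rule primitive_on_glue[OF primitive_on_step[OF \<kappa>\<gamma>] primitive_on_subset[OF extremal.F[OF E(3)] \<gamma>0 order_refl] glueF])
    have "primitive_on 0 1 G (\<lambda>t. if t \<le> \<gamma> then (if t \<le> \<kappa> * \<gamma> then exp l else exp ?\<mu>) else exp (u + p * logplus \<alpha> t))"
      unfolding G_def[abs_def]
      by (rule primitive_on_glue[OF primitive_on_step[OF \<kappa>\<gamma>] primitive_on_subset[OF extremal.G[OF E(3)] \<gamma>0 order_refl] glueG])
    then show "primitive_on 0 1 G (\<lambda>t. exp (\<phi> t))"
      by (rule primitive_on_cong) (simp add: \<phi>_def)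
    fix s t :: real assume st: "0 \<le> s" "s < t" "t \<le> 1"
    consider "t \<le> \<gamma>" | "\<gamma> \<le> s" | "s < \<gamma>" "\<gamma> < t" by linarith
    then show "below_arc C F G s t"
    proof cases
      case 1
      then show ?thesis
        using below_arc_step[OF st(2), of l ?\<mu> "\<kappa> * \<gamma>"] left[of s] left[of t] st e by (simp add: below_arc_def)
    next
      case 2
      then show ?thesis
        using P_below_arc_log[OF st(1,2), of \<alpha> u] right[of s] right[of t] st by (simp add: below_arc_def)
    next
      case 3
      let ?\<nu> = "u + p * logplus \<alpha> t"
      have "?\<nu> \<le> ?\<mu>"
      proof (cases "t \<le> \<alpha>")
        case True
        have "0 < \<gamma>" using 3 st by simp
        then have "\<alpha> / t \<le> \<alpha> / \<gamma>" using 3 \<gamma>\<alpha> by (intro divide_left_mono) auto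
        then have "ln (\<alpha> / t) \<le> ln (\<alpha> / \<gamma>)"
          using 3 \<open>0 < \<gamma>\<close> \<gamma>\<alpha> by (intro ln_mono) auto
        then have "ln (\<alpha> / t) \<le> (?\<mu> - u) / p" unfolding ln\<gamma>[OF \<open>0 < \<gamma>\<close>] .
        then have "p * ln (\<alpha> / t) \<le> ?\<mu> - u" using e by (simp add: field_simps)
        then show ?thesis using True by (simp add: logplus_def)
      qed (use u in \<open>simp add: logplus_def\<close>)
      from gap_left[OF this st(1)] 3 have "0 \<le> gap p ?\<nu> F G s" by simp
      moreover have "gap p ?\<nu> F G t = 0"
        using P_gap_log_eq_0[of t u \<alpha>] right[of t] 3 st by (simp add: gap_def)
      ultimately show ?thesis by (intro P_below_arcI[OF st(2), of ?\<nu>]) simp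
    qed
  qed (use Q in auto)
  have F0: "F 0 = 0" "G 0 = 0" using left[of 0] \<gamma>0 \<kappa>\<gamma> by (simp_all add: step_prim_def)
  have x': "(F 1 - F 0, G 1 - G 0) = x"
    using E(4) right[OF \<gamma>1] E(1) F0 by (simp add: logprim_0)
  have "ereal (\<kappa> * \<gamma>) \<le> bellman_D l C Q x"
    unfolding x'[symmetric] by (rule extremal.bellman_D_ge[OF ext]) (use \<kappa>\<gamma> \<gamma>1 in \<open>auto simp: \<phi>_def\<close>)
  moreover have "1 / (p - m) * exp ((p - m + u - l) / p) * (fst x - u) = \<kappa> * \<gamma>"
  proof -
    have "u - ?\<mu> = p - m + u - l" by simp
    then show ?thesis using e by (simp add: \<kappa>_def \<gamma>_def \<alpha>_def)
  qed
  ultimately show ?thesis by (simp add: u_def)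
qed

lemma bellman_D_cand: "ereal (cand_D l C x) \<le> bellman_D l C Q x"
  using bellman_D_1 bellman_D_2 bellman_D_3 bellman_D_4[OF x Q] bellman_D_nonneg[OF x Q] C1
  by (auto simp: cand_D_def simp flip: one_ereal_def zero_ereal_def)

end

end

text \<open>For \<open>C = 1\<close> the arc is the lower boundary itself, and constants are
  extremal.\<close>

lemma Omega_1_bellman:
  assumes "x \<in> Omega 1" and Q: "a < b" "{a<..<b} \<subseteq> Q" "Q \<subseteq> {a..b}"
  shows "bellman_b p 1 Q x \<le> ereal (cand_b p 1 x)" "ereal (cand_B2 1 x) \<le> bellman_B2 1 Q x"
    "ereal (cand_A \<delta> 1 x) \<le> bellman_A \<delta> 1 Q x" "ereal (cand_D l 1 x) \<le> bellman_D l 1 Q x"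
proof -
  define c where "c = fst x"
  have x: "x = (c, exp c)" using assms(1) by (auto simp: Omega_def c_def)
  have ext: "extremal 1 Q a b (\<lambda>t. c) (\<lambda>t. c * t) (\<lambda>t. exp c * t)"
    by (rule extremal_const[OF Q]) simp
  have H: "primitive_on 0 1 (\<lambda>t. k * t) (\<lambda>t. k)" for k using primitive_on_const[of 0 1 k 0] by simp
  show "bellman_b p 1 Q x \<le> ereal (cand_b p 1 x)"
    using extremal.bellman_b_le[OF ext H, of p] by (simp add: x cand_b_def)
  show "ereal (cand_B2 1 x) \<le> bellman_B2 1 Q x"
    using extremal.bellman_B2_ge[OF ext H] by (simp add: x cand_B2_def)
  show "ereal (cand_A \<delta> 1 x) \<le> bellman_A \<delta> 1 Q x"
    using extremal.bellman_A_ge[OF ext H, of \<delta>] by (simp add: x cand_A_def)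
  show "ereal (cand_D l 1 x) \<le> bellman_D l 1 Q x"
    using extremal.bellman_D_ge[OF ext, of 1 l] extremal.bellman_D_ge[OF ext, of 0 l] by (cases "l \<le> c") (simp_all add: x cand_D_def)
qed

(* The bound on \<delta> is taken in ereal, where 1 / 0 = \<infinity>, as required when C = 1. *)
theorem lemma5p1:
  fixes C :: real and Q :: "real set"
  assumes "1 \<le> C" and "proper_interval Q"
  shows "(\<forall>p\<in>{1..2}. \<forall>x\<in>Omega C. bellman_b p C Q x \<le> ereal (cand_b p C x)) \<and>
         (\<forall>x\<in>Omega C. ereal (cand_B2 C x) \<le> bellman_B2 C Q x) \<and>
         (\<forall>\<delta>::real. 1 \<le> \<delta> \<and> ereal \<delta> < 1 / ereal (xi_plus C) \<longrightarrow>
            (\<forall>x\<in>Omega C. ereal (cand_A \<delta> C x) \<le> bellman_A \<delta> C Q x)) \<and>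
         (\<forall>l::real. \<forall>x\<in>Omega C. ereal (cand_D l C x) \<le> bellman_D l C Q x)"
proof -
  from proper_interval_endpoints[OF assms(2)] obtain a b
    where Q: "a < b" "{a<..<b} \<subseteq> Q" "Q \<subseteq> {a..b}" .
  show ?thesis
  proof (cases "C = 1")
    case True
    then show ?thesis using Omega_1_bellman[OF _ Q] by blast
  next
    case False
    then have arc: "arc C" using assms(1) by unfold_locales simp
    note p = xi_plus_props(1)[OF arc.C1[OF arc]]
    have "bellman_b q C Q x \<le> ereal (cand_b q C x)" if "q \<in> {1..2}" "x \<in> Omega C" for q x
      using arc.bellman_b1[OF arc that(2) Q] arc.bellman_b_powr[OF arc that(2) Q, of q] that(1)
      by (cases "q = 1") auto
    moreover have "ereal (cand_A \<delta> C x) \<le> bellman_A \<delta> C Q x"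
      if "ereal \<delta> < 1 / ereal (xi_plus C)" "x \<in> Omega C" for \<delta> x
    proof (rule arc.bellman_A_cand[OF arc that(2) Q])
      have "ereal \<delta> < ereal (1 / xi_plus C)" using that(1) p by (simp add: one_ereal_def)
      then show "\<delta> * xi_plus C < 1" using p by (simp add: field_simps)
    qed
    ultimately show ?thesis
      using arc.bellman_B2_cand[OF arc _ Q] arc.bellman_D_cand[OF arc _ Q] by blast
  qed
qed

end
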